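(* Let $X$ be a compact metric space and let $f:X\to X$ be a topologically transitive homeomorphism satisfying the closing property. Let $m\in\mathbb N$, $\alpha>0$, and let $A:X\to GL(m,\mathbb R)$ be an $\alpha$-H\"older function such that $$A(f^{n-1}p)\cdots A(fp)\,A(p)=\mathrm{Id}\qquad\text{for all } p\in X,\ n\in\mathbb N \text{ with } f^np=p.$$ Then there exists an $\alpha$-H\"older function $C:X\to GL(m,\mathbb R)$ such that $$A(x)=C(fx)\,C(x)^{-1}\qquad\text{for all } x\in X.$$
   Context: $\mathbb N$ denotes the positive integers. A homeomorphism $f$ of $X$ is topologically transitive if it has a dense orbit $\{f^kz\}_{k\in\mathbb Z}$ for some $z\in X$. For $\lambda>0$, orbit segments $x,fx,\dots,f^nx$ and $p,fp,\dots,f^np$ are called exponentially $\delta$ close with exponent $\lambda$ if $\mathrm{dist}(f^ix,f^ip)\le\delta\exp(-\lambda\min\{i,n-i\})$ for every $i=0,\dots,n$. A homeomorphism $f$ of a metric space $X$ satisfies the closing property if there exist $c,\lambda,\delta_0>0$ such that for any $x\in X$ and $n>0$ with $\mathrm{dist}(x,f^nx)<\delta_0$ there exists $p\in X$ with $f^np=p$ such that, with $\delta=c\,\mathrm{dist}(x,f^nx)$, the orbit segments $x,fx,\dots,f^nx$ and $p,fp,\dots,f^np$ are exponentially $\delta$ close with exponent $\lambda$, and there exists $y\in X$ such that for every $i=0,\dots,n$ $$\mathrm{dist}(f^ip,f^iy)\le\delta e^{-\lambda i}\quad\text{and}\quad \mathrm{dist}(f^iy,f^ix)\le\delta e^{-\lambda(n-i)}.$$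 $GL(m,\mathbb R)$ carries the metric $\mathrm{dist}(A,B)=\|A-B\|+\|A^{-1}-B^{-1}\|$, where $\|\cdot\|$ is the operator norm for the standard Euclidean norm on $\mathbb R^m$. A function $A:X\to GL(m,\mathbb R)$ is $\alpha$-H\"older if it is H\"older continuous with exponent $\alpha$ with respect to this metric; since $X$ is compact this is equivalent to the existence of a constant $c$ with $\|A(x)-A(y)\|\le c\,\mathrm{dist}(x,y)^\alpha$ for all $x,y\in X$. *)

theory Defs
  imports "HOL-Analysis.Analysis"
begin

text \<open>
  The phase space is a subset \<open>X\<close> of a metric space type, with the induced metric, and only the
  values of \<open>f\<close> on \<open>X\<close> matter.
\<close>

definition int_iterate :: "'a set \<Rightarrow> ('a \<Rightarrow> 'a) \<Rightarrow> int \<Rightarrow> 'a \<Rightarrow> 'a" where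
  "int_iterate X f k z =
     (if k \<ge> 0 then (f ^^ nat k) z else (inv_into X f ^^ nat (- k)) z)"

definition topologically_transitive :: "('a::metric_space) set \<Rightarrow> ('a \<Rightarrow> 'a) \<Rightarrow> bool" where
  "topologically_transitive X f \<longleftrightarrow>
     (\<exists>z\<in>X. X \<subseteq> closure (range (\<lambda>k. int_iterate X f k z)))"

definition exponentially_close ::
    "(('a::metric_space) \<Rightarrow> 'a) \<Rightarrow> real \<Rightarrow> real \<Rightarrow> nat \<Rightarrow> 'a \<Rightarrow> 'a \<Rightarrow> bool" where
  "exponentially_close f \<delta> l n x p \<longleftrightarrow>
     (\<forall>i\<le>n. dist ((f ^^ i) x) ((f ^^ i) p) \<le> \<delta> * exp (- l * real (min i (n - i))))"

definition closing_property :: "('a::metric_space) set \<Rightarrow> ('a \<Rightarrow> 'a) \<Rightarrow> bool" where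
  "closing_property X f \<longleftrightarrow>
     (\<exists>c>0. \<exists>l>0. \<exists>\<delta>\<^sub>0>0. \<forall>x\<in>X. \<forall>n>0. dist x ((f ^^ n) x) < \<delta>\<^sub>0 \<longrightarrow>
        (let \<delta> = c * dist x ((f ^^ n) x) in
          \<exists>p\<in>X. (f ^^ n) p = p \<and> exponentially_close f \<delta> l n x p \<and>
            (\<exists>y\<in>X. \<forall>i\<le>n.
               dist ((f ^^ i) p) ((f ^^ i) y) \<le> \<delta> * exp (- l * real i) \<and>
               dist ((f ^^ i) y) ((f ^^ i) x) \<le> \<delta> * exp (- l * real (n - i)))))"

definition GL :: "(real^'m^'m) set" where
  "GL = {A. invertible A}"

definition op_norm :: "real^'m^'m \<Rightarrow> real" where
  "op_norm A = onorm (\<lambda>v. A *v v)"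

definition dist_GL :: "real^'m^'m \<Rightarrow> real^'m^'m \<Rightarrow> real" where
  "dist_GL A B = op_norm (A - B) + op_norm (matrix_inv A - matrix_inv B)"

definition holder_GL ::
    "real \<Rightarrow> ('a::metric_space) set \<Rightarrow> ('a \<Rightarrow> real^'m^'m) \<Rightarrow> bool" where
  "holder_GL \<alpha> X A \<longleftrightarrow>
     A \<in> X \<rightarrow> GL \<and>
     (\<exists>c. \<forall>x\<in>X. \<forall>y\<in>X. dist_GL (A x) (A y) \<le> c * dist x y powr \<alpha>)"

primrec cocycle :: "('a \<Rightarrow> 'a) \<Rightarrow> ('a \<Rightarrow> real^'m^'m) \<Rightarrow> nat \<Rightarrow> 'a \<Rightarrow> real^'m^'m" where
  "cocycle f A 0 x = mat 1"
| "cocycle f A (Suc n) x = A ((f ^^ n) x) ** cocycle f A n x"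

end

theory Submission
  imports Defs
begin

text \<open>
  Livsic's theorem for matrix cocycles. Write \<open>A(x, n)\<close> for the product of \<open>A\<close> along the orbit of \<open>x\<close> up to
  time \<open>n\<close>. On the dense orbit of a point \<open>z\<close> the equation determines the solution up to right
  multiplication by a constant matrix, namely as \<open>C(f\<^sup>k z) = A(z, k)\<close>. All that has to be
  shown is that this function is Hoelder on the orbit; then it extends to \<open>X\<close> and satisfies the equation there by continuity. Hence \<open>A(x, n)\<close> must be close to the identity,
  of the order of \<open>dist(x, f\<^sup>n x)\<^sup>\<alpha>\<close>, whenever \<open>f\<^sup>n x\<close> is close to \<open>x\<close>. By the closing property the segment is
  shadowed by a periodic orbit, along which the product is the identity, and the comparison of the two products
  (\<open>cocycle_near_one_on_return\<close>) is a summation of exponentially small errors, provided that products of the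
  cocycle and of its inverse grow more slowly than the errors decay.

  The heart of the matter is therefore that the cocycle grows subexponentially in norm
  (\<open>subexponential_growth\<close>). Suppose that its top exponent \<open>\<Lambda>\<close> is positive. Scaling the cocycle makes the
  exponent a small number \<open>q > 0\<close> while all periodic products keep norm at most one, so it is enough to find a
  periodic product of norm above one (\<open>expanding_periodic_orbit\<close>). Three observations about products along
  segments lead to it. First, on a long segment that grows almost at the rate \<open>q\<close>, all subsegments
  of proportional length do so as well, because no segment grows much faster than \<open>q\<close>; by the pigeonhole principle one of them is a close return
  (\<open>expanding_close_return\<close>). Secondly, the subsegment of the returning segment with the largest product omits
  only a small proportion of it. Thirdly, a product that is maximal among its subsegments is stable under
  errors that decay away from the ends of the segment (\<open>cocycle_perturbation\<close>): the product before or after an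
  error can be estimated by maximality, so only the shorter one of the two has to be estimated by the growth
  rate. Hence the shadowing periodic orbit expands on the subsegment, and the omitted ends are too short to destroy
  this.

  The inverse of the cocycle is, up to transposition, a cocycle over the same map with the same periodic
  data (\<open>cocycle_transpose_inverse\<close>), so the growth estimate applies to it too.
\<close>

section \<open>The operator norm on square matrices\<close>

lemma op_norm_apply: "norm (A *v v) \<le> op_norm A * norm v"
  for A :: "real^'m^'m"
  unfolding op_norm_def by (rule onorm) simp

lemma op_norm_least:
  fixes A :: "real^'m^'m"
  assumes "\<And>v. norm (A *v v) \<le> b * norm v"
  shows "op_norm A \<le> b"
  unfolding op_norm_def using assms by (rule onorm_le)

lemma op_norm_nonneg [simp]: "0 \<le> op_norm A"
  unfolding op_norm_def by (rule onorm_pos_le) simp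

lemma op_norm_zero [simp]: "op_norm (0 :: real^'m^'m) = 0"
  by (intro antisym op_norm_least op_norm_nonneg) simp

lemma op_norm_one [simp]: "op_norm (mat 1 :: real^'m^'m) = 1"
proof -
  have "(\<lambda>v::real^'m. mat 1 *v v) = (\<lambda>v. v)" by simp
  then show ?thesis unfolding op_norm_def by (simp only: onorm_id)
qed

lemma op_norm_mult: "op_norm (A ** B) \<le> op_norm A * op_norm B"
proof -
  have "(\<lambda>v. (A ** B) *v v) = (\<lambda>v. A *v v) \<circ> (\<lambda>v. B *v v)"
    by (simp add: fun_eq_iff matrix_vector_mul_assoc)
  then show ?thesis
    unfolding op_norm_def by (simp add: onorm_compose)
qed

lemma op_norm_triangle: "op_norm (A + B) \<le> op_norm A + op_norm B"
  unfolding op_norm_def matrix_vector_mult_add_rdistrib by (rule onorm_triangle) simp_all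

lemma op_norm_scaleR: "op_norm (c *\<^sub>R A) = \<bar>c\<bar> * op_norm A"
  unfolding op_norm_def scaleR_matrix_vector_assoc[symmetric] by (rule onorm_scaleR) simp

lemma op_norm_minus: "op_norm (- A) = op_norm A"
  using op_norm_scaleR[of "-1" A] by simp

lemma op_norm_minus_commute: "op_norm (A - B) = op_norm (B - A)"
  using op_norm_minus[of "A - B"] by simp

lemma op_norm_triangle_le_add_diff: "op_norm A \<le> op_norm B + op_norm (A - B)"
  using op_norm_triangle[of B "A - B"] by simp

lemma op_norm_sum: "op_norm (\<Sum>i\<in>I. A i) \<le> (\<Sum>i\<in>I. op_norm (A i))"
proof (induction I rule: infinite_finite_induct)
  case (insert i I)
  then show ?case using op_norm_triangle[of "A i" "\<Sum>i\<in>I. A i"] by simp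
qed simp_all

lemma op_norm_mult3: "op_norm (A ** B ** C) \<le> op_norm A * op_norm B * op_norm C"
  by (rule order_trans[OF op_norm_mult]) (simp add: op_norm_mult mult_right_mono)

text \<open>
  From \<open>|A\<^sup>T v|\<^sup>2 = v \<bullet> A A\<^sup>T v \<le> |v| |A| |A\<^sup>T v|\<close>.
\<close>

lemma op_norm_transpose_le: "op_norm (transpose A) \<le> op_norm A"
proof (rule op_norm_least)
  fix v
  let ?w = "transpose A *v v"
  have "norm ?w * norm ?w = ?w \<bullet> ?w"
    by (metis norm_eq_square power2_eq_square power2_norm_eq_inner)
  also have "\<dots> = v \<bullet> (A *v ?w)"
    using dot_lmul_matrix[of v A ?w] by simp
  also have "\<dots> \<le> norm v * norm (A *v ?w)"
    by (rule norm_cauchy_schwarz)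
  also have "\<dots> \<le> norm v * (op_norm A * norm ?w)"
    by (intro mult_left_mono op_norm_apply) simp
  finally have "norm ?w * norm ?w \<le> (op_norm A * norm v) * norm ?w"
    by (simp add: mult_ac)
  then show "norm ?w \<le> op_norm A * norm v"
    by (cases "norm ?w = 0") (auto dest: mult_right_le_imp_le)
qed

lemma op_norm_transpose [simp]: "op_norm (transpose A) = op_norm A"
  using op_norm_transpose_le[of A] op_norm_transpose_le[of "transpose A"] by simp

lemma transpose_diff: "transpose (A - B) = transpose A - transpose B"
  by (simp add: transpose_def vec_eq_iff)

lemma matrix_mult_diff_distrib_left: "A ** (B - C) = A ** B - A ** C"
  for A :: "real^'m^'m"
  using matrix_add_ldistrib[of A "B - C" C] by simp

lemma matrix_mult_add_distrib_right: "(A + B) ** C = A ** C + B ** C"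
  for A :: "real^'m^'m"
  by (simp add: matrix_matrix_mult_def vec_eq_iff sum.distrib algebra_simps)

lemma matrix_mult_diff_distrib_right: "(A - B) ** C = A ** C - B ** C"
  for A :: "real^'m^'m"
  using matrix_mult_add_distrib_right[of "A - B" B C] by simp

lemma matrix_mult_sum_left: "(\<Sum>i\<in>I. A i) ** B = (\<Sum>i\<in>I. A i ** B)"
  for A :: "'i \<Rightarrow> real^'m^'m"
  by (induction I rule: infinite_finite_induct) (simp_all add: matrix_mult_add_distrib_right)

lemma matrix_mult_sum_right: "B ** (\<Sum>i\<in>I. A i) = (\<Sum>i\<in>I. B ** A i)"
  for A :: "'i \<Rightarrow> real^'m^'m"
  by (induction I rule: infinite_finite_induct) (simp_all add: matrix_add_ldistrib)

lemma matrix_inv_right: "invertible A \<Longrightarrow> A ** matrix_inv A = mat 1"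
  and matrix_inv_left: "invertible A \<Longrightarrow> matrix_inv A ** A = mat 1"
  unfolding invertible_def matrix_inv_def by (metis (mono_tags, lifting) someI_ex)+

lemma matrix_inv_eqI:
  fixes A :: "real^'m^'m"
  assumes "A ** B = mat 1"
  shows "invertible A" "matrix_inv A = B"
proof -
  show inv: "invertible A"
    using assms invertible_right_inverse by blast
  have "matrix_inv A = matrix_inv A ** (A ** B)"
    using assms by simp
  then show "matrix_inv A = B"
    by (simp add: matrix_mul_assoc matrix_inv_left inv)
qed

lemma matrix_inv_mult:
  fixes A B :: "real^'m^'m"
  assumes "invertible A" "invertible B"
  shows "matrix_inv (A ** B) = matrix_inv B ** matrix_inv A"
proof -
  have "A ** B ** (matrix_inv B ** matrix_inv A) = A ** (B ** matrix_inv B) ** matrix_inv A"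
    by (simp add: matrix_mul_assoc)
  then show ?thesis
    using assms by (intro matrix_inv_eqI(2)) (simp add: matrix_inv_right)
qed

lemma matrix_inv_one [simp]: "matrix_inv (mat 1 :: real^'m^'m) = mat 1"
  by (rule matrix_inv_eqI(2)) simp

lemma invertible_matrix_inv: "invertible A \<Longrightarrow> invertible (matrix_inv A)"
  for A :: "real^'m^'m"
  by (rule matrix_inv_eqI(1)[OF matrix_inv_left])

lemma matrix_inv_matrix_inv: "invertible A \<Longrightarrow> matrix_inv (matrix_inv A) = A"
  for A :: "real^'m^'m"
  by (rule matrix_inv_eqI(2)[OF matrix_inv_left])

lemma matrix_inv_transpose:
  "invertible A \<Longrightarrow> matrix_inv (transpose A) = transpose (matrix_inv A)"
  for A :: "real^'m^'m"
  by (rule matrix_inv_eqI(2)) (simp add: matrix_transpose_mul[symmetric] matrix_inv_left)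

text \<open>The identity \<open>B\<inverse> - 1 = B\<inverse> (1 - B)\<close> absorbs the unknown norm of the inverse.\<close>

lemma op_norm_inverse_near_one:
  fixes B :: "real^'m^'m"
  assumes "invertible B" "op_norm (B - mat 1) \<le> 1/2"
  shows "op_norm (matrix_inv B) \<le> 2"
    and "op_norm (matrix_inv B - mat 1) \<le> 2 * op_norm (B - mat 1)"
proof -
  have eq: "matrix_inv B - mat 1 = matrix_inv B ** (mat 1 - B)"
    using assms by (simp add: matrix_mult_diff_distrib_left matrix_inv_left)
  have 1: "op_norm (matrix_inv B - mat 1) \<le> op_norm (matrix_inv B) * op_norm (B - mat 1)"
    unfolding eq using op_norm_mult[of "matrix_inv B" "mat 1 - B"] op_norm_minus_commute[of B "mat 1"] by simp
  also have "\<dots> \<le> op_norm (matrix_inv B) * (1/2)"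
    using assms(2) by (intro mult_left_mono) simp_all
  finally show 2: "op_norm (matrix_inv B) \<le> 2"
    using op_norm_triangle_le_add_diff[of "matrix_inv B" "mat 1"] by simp
  have "op_norm (matrix_inv B) * op_norm (B - mat 1) \<le> 2 * op_norm (B - mat 1)"
    by (intro mult_right_mono 2) simp
  with 1 show "op_norm (matrix_inv B - mat 1) \<le> 2 * op_norm (B - mat 1)" by simp
qed

lemma op_norm_le_norm:
  fixes A :: "real^'m^'m"
  shows "op_norm A \<le> (real CARD('m))\<^sup>2 * norm A"
proof -
  have "\<bar>A $ i $ j\<bar> \<le> norm A" for i j
    using component_le_norm_cart[of "A $ i" j] Finite_Cartesian_Product.norm_nth_le[of A i] by linarith
  from onorm_le_matrix_component[OF this] show ?thesis
    unfolding op_norm_def by (simp add: power2_eq_square)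
qed

lemma norm_le_op_norm:
  fixes A :: "real^'m^'m"
  shows "norm A \<le> (real CARD('m))\<^sup>2 * op_norm A"
proof -
  have "norm A \<le> (\<Sum>i\<in>UNIV. norm (A $ i))"
    unfolding norm_vec_def by (rule L2_set_le_sum) simp
  also have "\<dots> \<le> (\<Sum>i\<in>(UNIV::'m set). \<Sum>j\<in>(UNIV::'m set). op_norm A)"
    unfolding op_norm_def
    by (intro sum_mono order_trans[OF norm_le_l1_cart] matrix_component_le_onorm)
  finally show ?thesis by (simp add: power2_eq_square)
qed

lemma tendsto_op_norm:
  fixes M :: "'i \<Rightarrow> real^'m^'m"
  assumes "(M \<longlongrightarrow> L) F"
  shows "((\<lambda>i. op_norm (M i)) \<longlongrightarrow> op_norm L) F"
proof -
  have "((\<lambda>i. norm (M i - L)) \<longlongrightarrow> 0) F"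
    using assms by (simp add: LIM_zero tendsto_norm_zero)
  then have lim: "((\<lambda>i. (real CARD('m))\<^sup>2 * norm (M i - L)) \<longlongrightarrow> 0) F"
    by (rule tendsto_mult_right_zero)
  have "\<bar>op_norm (M i) - op_norm L\<bar> \<le> (real CARD('m))\<^sup>2 * norm (M i - L)" for i
    using op_norm_triangle_le_add_diff[of "M i" L] op_norm_triangle_le_add_diff[of L "M i"]
      op_norm_minus_commute[of L "M i"] op_norm_le_norm[of "M i - L"] by linarith
  then have "((\<lambda>i. op_norm (M i) - op_norm L) \<longlongrightarrow> 0) F"
    by (intro Lim_null_comparison[OF _ lim]) simp
  then show ?thesis by (simp add: LIM_zero_iff)
qed

lemma bounded_bilinear_matrix_mult: "bounded_bilinear ((**) :: real^'m^'m \<Rightarrow> real^'m^'m \<Rightarrow> real^'m^'m)"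
  unfolding bilinear_conv_bounded_bilinear[symmetric] bilinear_def
  by (auto intro!: linearI
      simp: matrix_add_ldistrib matrix_mult_add_distrib_right matrix_scalar_ac scalar_matrix_assoc)

lemmas tendsto_matrix_mult = bounded_bilinear.tendsto[OF bounded_bilinear_matrix_mult]

section \<open>Cocycles\<close>

lemma funpow_in: "f ` X \<subseteq> X \<Longrightarrow> x \<in> X \<Longrightarrow> (f ^^ n) x \<in> X"
  by (induction n) auto

lemma cocycle_add:
  "cocycle f A (m + n) x = cocycle f A m ((f ^^ n) x) ** cocycle f A n x"
  by (induction m) (simp_all add: funpow_add matrix_mul_assoc)

lemma cocycle_split:
  "i \<le> n \<Longrightarrow> cocycle f A n x = cocycle f A (n - i) ((f ^^ i) x) ** cocycle f A i x"
  using cocycle_add[of f A "n - i" i x] by simp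

lemma cocycle_scaleR: "cocycle f (\<lambda>x. c *\<^sub>R A x) n x = c ^ n *\<^sub>R cocycle f A n x"
  by (induction n) (simp_all add: matrix_scalar_ac scalar_matrix_assoc[symmetric])

lemma invertible_one: "invertible (mat 1 :: real^'m^'m)"
  by (rule matrix_inv_eqI(1)[of _ "mat 1"]) simp

lemma invertible_cocycle:
  fixes A :: "'a \<Rightarrow> real^'m^'m"
  assumes "f ` X \<subseteq> X" "A \<in> X \<rightarrow> GL" "x \<in> X"
  shows "invertible (cocycle f A n x)"
proof (induction n)
  case (Suc n)
  have "invertible (A ((f ^^ n) x))"
    using assms funpow_in[of f X x n] by (auto simp: GL_def)
  then show ?case using Suc by (simp add: invertible_mult)
qed (simp add: invertible_one)

text \<open>
  Products of inverses come in the reversed order; transposing them restores the order, so the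
  inverse of a cocycle is, up to transposition, again a cocycle over the same map.
\<close>

lemma cocycle_transpose_inverse:
  fixes A :: "'a \<Rightarrow> real^'m^'m"
  assumes "f ` X \<subseteq> X" "A \<in> X \<rightarrow> GL" "x \<in> X"
  shows "cocycle f (\<lambda>x. transpose (matrix_inv (A x))) n x = transpose (matrix_inv (cocycle f A n x))"
proof (induction n)
  case (Suc n)
  have "invertible (A ((f ^^ n) x))"
    using assms funpow_in[of f X x n] by (auto simp: GL_def)
  then show ?case
    using Suc invertible_cocycle[OF assms, of n]
    by (simp add: matrix_inv_mult matrix_transpose_mul)
qed simp

lemma op_norm_cocycle_le:
  assumes "f ` X \<subseteq> X" "x \<in> X" "\<And>x. x \<in> X \<Longrightarrow> op_norm (A x) \<le> b" "0 \<le> b"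
  shows "op_norm (cocycle f A n x) \<le> b ^ n"
proof (induction n)
  case (Suc n)
  have "op_norm (cocycle f A (Suc n) x) \<le> op_norm (A ((f ^^ n) x)) * op_norm (cocycle f A n x)"
    by (simp add: op_norm_mult)
  also have "\<dots> \<le> b * b ^ n"
    using Suc assms funpow_in[of f X x n] by (intro mult_mono) auto
  finally show ?case by simp
qed simp

text \<open>
  A telescoping sum: the \<open>i\<close>-th term already carries the factors along the orbit of \<open>p\<close> up to time
  \<open>i\<close> and still carries those along the orbit of \<open>x\<close> afterwards.
\<close>

lemma cocycle_diff:
  fixes A :: "'a \<Rightarrow> real^'m^'m"
  shows "cocycle f A n p - cocycle f A n x =
    (\<Sum>i<n. cocycle f A (n - Suc i) ((f ^^ Suc i) x) ** (A ((f ^^ i) p) - A ((f ^^ i) x)) ** cocycle f A i p)"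
proof (induction n)
  case (Suc n)
  let ?t = "\<lambda>n i. cocycle f A (n - Suc i) ((f ^^ Suc i) x) ** (A ((f ^^ i) p) - A ((f ^^ i) x)) ** cocycle f A i p"
  have step: "A ((f ^^ n) x) ** ?t n i = ?t (Suc n) i" if "i < n" for i
  proof -
    have "Suc n - Suc i = Suc (n - Suc i)" using that by simp
    moreover have "(f ^^ (n - Suc i)) ((f ^^ Suc i) x) = (f ^^ n) x"
      using that by (metis Suc_leI comp_apply funpow_add le_add_diff_inverse2)
    ultimately show ?thesis
      by (simp add: matrix_mul_assoc)
  qed
  have "cocycle f A (Suc n) p - cocycle f A (Suc n) x
      = (A ((f ^^ n) p) - A ((f ^^ n) x)) ** cocycle f A n p
        + A ((f ^^ n) x) ** (cocycle f A n p - cocycle f A n x)"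
    by (simp add: matrix_mult_diff_distrib_left matrix_mult_diff_distrib_right)
  also have "\<dots> = ?t (Suc n) n + (\<Sum>i<n. ?t (Suc n) i)"
    unfolding Suc by (simp add: matrix_mult_sum_right step del: cocycle.simps(2) funpow.simps)
  finally show ?case by simp
qed simp

section \<open>Perturbation of a product of nearly maximal growth\<close>

lemma sum_exp_le:
  assumes "0 < k"
  shows "(\<Sum>i<n. exp (- k * real i)) \<le> 1 / (1 - exp (- k))"
proof -
  have "(\<Sum>i<n. exp (- k * real i)) = (\<Sum>i<n. exp (- k) ^ i)"
    by (simp add: exp_of_nat_mult[symmetric] mult.commute)
  also have "\<dots> = (1 - exp (- k) ^ n) / (1 - exp (- k))"
    using assms by (simp add: sum_gp_strict)
  also have "\<dots> \<le> 1 / (1 - exp (- k))"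
    using assms by (intro divide_right_mono) simp_all
  finally show ?thesis .
qed

lemma sum_exp_rev_le:
  assumes "0 < k"
  shows "(\<Sum>i<n. exp (- k * real (n - i))) \<le> 1 / (1 - exp (- k))"
proof -
  have "(\<Sum>i<n. exp (- k * real (n - i))) \<le> (\<Sum>i<n. exp (- k * real (n - Suc i)))"
    using assms by (intro sum_mono) (simp add: of_nat_diff)
  also have "\<dots> = (\<Sum>i<n. exp (- k * real i))"
    by (rule sum.nat_diff_reindex)
  finally show ?thesis using sum_exp_le[OF assms, of n] by linarith
qed

text \<open>
  The error made at time \<open>i\<close> has size \<open>\<theta> exp (- \<eta> min i (n - i))\<close>, while the products before and after it
  could together exceed the bound \<open>N\<close> by a factor of order \<open>exp (q n)\<close>, which
  is too much for \<open>i\<close> near the ends. That \<open>N\<close> bounds the products over all subsegments removes this: in the first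
  half the product after time \<open>i\<close> is at most \<open>N\<close>, so only the product up to time \<open>i\<close> is estimated by the
  growth rate, with loss \<open>exp (q i)\<close>; in the second half the roles are exchanged, with loss
  \<open>exp (q (n - i))\<close>. Both losses are beaten by the error as \<open>q < \<eta>\<close>, uniformly in \<open>n\<close>. In the second half
  one needs that the products along \<open>p\<close> are at most \<open>2 N\<close>; this is obtained by induction on their length
  from the same estimate.
\<close>

lemma cocycle_perturbation:
  fixes A :: "'a \<Rightarrow> real^'m^'m"
  assumes max: "\<And>i k. i + k \<le> n \<Longrightarrow> op_norm (cocycle f A k ((f ^^ i) x)) \<le> N"
    and growth_x: "\<And>i k. i + k \<le> n \<Longrightarrow> op_norm (cocycle f A k ((f ^^ i) x)) \<le> K * exp (q * real k)"
    and growth_p: "\<And>k. k \<le> n \<Longrightarrow> op_norm (cocycle f A k p) \<le> K * exp (q * real k)"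
    and close: "\<And>i. i < n \<Longrightarrow>
      op_norm (A ((f ^^ i) p) - A ((f ^^ i) x)) \<le> \<theta> * exp (- \<eta> * real (min i (n - i)))"
    and q: "0 \<le> q" "q < \<eta>"
    and small: "0 \<le> \<theta>" "8 * K * \<theta> \<le> 1 - exp (- (\<eta> - q))"
  shows "op_norm (cocycle f A n p - cocycle f A n x) \<le> N / 2"
proof -
  let ?k = "\<eta> - q"
  have N: "1 \<le> N" using max[of 0 0] by simp
  have K: "1 \<le> K" using growth_p[of 0] by simp
  have term_le: "op_norm (cocycle f A (m - Suc i) ((f ^^ Suc i) x) **
      (A ((f ^^ i) p) - A ((f ^^ i) x)) ** cocycle f A i p)
      \<le> 2 * N * K * \<theta> * (exp (- ?k * real i) + exp (- ?k * real (n - i)))" (is "op_norm (?P ** ?E ** ?Q) \<le> _")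
    if "i < m" "m \<le> n" "op_norm (cocycle f A i p) \<le> 2 * N" for i m
  proof (cases "i \<le> n - i")
    case True
    have double: "a \<le> 2 * (a + b)" if "0 < a" "0 < b" for a b :: real
      using that by simp
    have "op_norm (?P ** ?E ** ?Q) \<le> op_norm ?P * op_norm ?E * op_norm ?Q"
      by (rule op_norm_mult3)
    also have "\<dots> \<le> N * (\<theta> * exp (- \<eta> * real i)) * (K * exp (q * real i))"
      using that True N small(1) max[of "Suc i" "m - Suc i"] close[of i] growth_p[of i]
      by (intro mult_mono) auto
    also have "\<dots> = N * K * \<theta> * exp (- ?k * real i)"
      by (simp add: algebra_simps flip: exp_add)
    also have "\<dots> \<le> N * K * \<theta> * (2 * (exp (- ?k * real i) + exp (- ?k * real (n - i))))"
      using N K small(1) by (intro mult_left_mono double) simp_all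
    finally show ?thesis by (simp add: mult_ac)
  next
    case False
    have "op_norm (?P ** ?E ** ?Q) \<le> op_norm ?P * op_norm ?E * op_norm ?Q"
      by (rule op_norm_mult3)
    also have "\<dots> \<le> (K * exp (q * real (m - Suc i))) * (\<theta> * exp (- \<eta> * real (n - i))) * (2 * N)"
      using that False N K small(1) growth_x[of "Suc i" "m - Suc i"] close[of i]
      by (intro mult_mono) (auto simp: min_def)
    also have "\<dots> \<le> (K * exp (q * real (n - i))) * (\<theta> * exp (- \<eta> * real (n - i))) * (2 * N)"
      using that q N K small(1) by (intro mult_mono) (auto intro!: mult_left_mono)
    also have "\<dots> = 2 * N * K * \<theta> * exp (- ?k * real (n - i))"
      by (simp add: algebra_simps flip: exp_add)
    also have "\<dots> \<le> 2 * N * K * \<theta> * (exp (- ?k * real i) + exp (- ?k * real (n - i)))"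
      using N K small(1) by (intro mult_left_mono) simp_all
    finally show ?thesis .
  qed
  have diff: "op_norm (cocycle f A m p - cocycle f A m x) \<le> N / 2"
    if "m \<le> n" "\<And>i. i < m \<Longrightarrow> op_norm (cocycle f A i p) \<le> 2 * N" for m
  proof -
    have "op_norm (cocycle f A m p - cocycle f A m x)
        \<le> (\<Sum>i<m. 2 * N * K * \<theta> * (exp (- ?k * real i) + exp (- ?k * real (n - i))))"
      unfolding cocycle_diff using that by (intro order_trans[OF op_norm_sum] sum_mono term_le) auto
    also have "\<dots> \<le> (\<Sum>i<n. 2 * N * K * \<theta> * (exp (- ?k * real i) + exp (- ?k * real (n - i))))"
      using that N K small(1) by (intro sum_mono2) (auto intro!: mult_nonneg_nonneg add_nonneg_nonneg)
    also have "\<dots> = 2 * N * K * \<theta> * ((\<Sum>i<n. exp (- ?k * real i)) + (\<Sum>i<n. exp (- ?k * real (n - i))))"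
      by (simp only: sum.distrib flip: sum_distrib_left)
    also have "\<dots> \<le> 2 * N * K * \<theta> * (1 / (1 - exp (- ?k)) + 1 / (1 - exp (- ?k)))"
      using N K q small(1) by (intro mult_left_mono add_mono sum_exp_le sum_exp_rev_le) simp_all
    also have "\<dots> = N / 2 * (8 * K * \<theta> / (1 - exp (- ?k)))"
      by simp
    also have "\<dots> \<le> N / 2 * 1"
      using N q small(2) by (intro mult_left_mono) simp_all
    finally show ?thesis by simp
  qed
  have "op_norm (cocycle f A m p) \<le> 2 * N" if "m \<le> n" for m
    using that
  proof (induction m rule: less_induct)
    case (less m)
    then have "op_norm (cocycle f A m p - cocycle f A m x) \<le> N / 2"
      by (intro diff) auto
    then show ?case
      using op_norm_triangle_le_add_diff[of "cocycle f A m p" "cocycle f A m x"] max[of 0 m] less.prems N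
      by simp
  qed
  then show ?thesis by (intro diff) auto
qed

section \<open>Hoelder functions into the general linear group\<close>

lemma holder_GL_invertible: "holder_GL \<alpha> X A \<Longrightarrow> x \<in> X \<Longrightarrow> invertible (A x)"
  by (auto simp: holder_GL_def GL_def)

lemma holder_GL_op_norm:
  assumes "holder_GL \<alpha> X A"
  obtains h where "0 < h"
    "\<And>x y. x \<in> X \<Longrightarrow> y \<in> X \<Longrightarrow> op_norm (A x - A y) \<le> h * dist x y powr \<alpha>"
    "\<And>x y. x \<in> X \<Longrightarrow> y \<in> X \<Longrightarrow> op_norm (matrix_inv (A x) - matrix_inv (A y)) \<le> h * dist x y powr \<alpha>"
proof -
  obtain c where c: "dist_GL (A x) (A y) \<le> c * dist x y powr \<alpha>" if "x \<in> X" "y \<in> X" for x y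
    using assms unfolding holder_GL_def by blast
  have "dist_GL (A x) (A y) \<le> max c 1 * dist x y powr \<alpha>" if "x \<in> X" "y \<in> X" for x y
    by (rule order_trans[OF c[OF that]]) (intro mult_right_mono, auto)
  note sum_le = this[unfolded dist_GL_def]
  have "op_norm (A x - A y) \<le> max c 1 * dist x y powr \<alpha>"
    "op_norm (matrix_inv (A x) - matrix_inv (A y)) \<le> max c 1 * dist x y powr \<alpha>"
    if "x \<in> X" "y \<in> X" for x y
    using sum_le[OF that] op_norm_nonneg[of "A x - A y"] op_norm_nonneg[of "matrix_inv (A x) - matrix_inv (A y)"]
    by linarith+
  then show ?thesis by (intro that[of "max c 1"]) auto
qed

lemma holder_GL_bounded:
  fixes X :: "'a::metric_space set"
  assumes "bounded X" "0 < \<alpha>" "holder_GL \<alpha> X A"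
  obtains b where "1 \<le> b"
    "\<And>x. x \<in> X \<Longrightarrow> op_norm (A x) \<le> b" "\<And>x. x \<in> X \<Longrightarrow> op_norm (matrix_inv (A x)) \<le> b"
proof (cases "X = {}")
  case False
  then obtain x0 where x0: "x0 \<in> X" by auto
  obtain h where h: "0 < h"
    "\<And>x y. x \<in> X \<Longrightarrow> y \<in> X \<Longrightarrow> op_norm (A x - A y) \<le> h * dist x y powr \<alpha>"
    "\<And>x y. x \<in> X \<Longrightarrow> y \<in> X \<Longrightarrow> op_norm (matrix_inv (A x) - matrix_inv (A y)) \<le> h * dist x y powr \<alpha>"
    using holder_GL_op_norm[OF assms(3)] by metis
  obtain d where d: "dist x x0 \<le> d" if "x \<in> X" for x
    using assms(1) by (metis bounded_any_center dist_commute)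
  have "h * dist x x0 powr \<alpha> \<le> h * d powr \<alpha>" if "x \<in> X" for x
    using d[OF that] h(1) assms(2) by (intro mult_left_mono powr_mono2) auto
  then have "op_norm (A x) \<le> op_norm (A x0) + h * d powr \<alpha>"
    "op_norm (matrix_inv (A x)) \<le> op_norm (matrix_inv (A x0)) + h * d powr \<alpha>" if "x \<in> X" for x
    using op_norm_triangle_le_add_diff[of "A x" "A x0"] h(2,3)[OF that x0] that
      op_norm_triangle_le_add_diff[of "matrix_inv (A x)" "matrix_inv (A x0)"] by fastforce+
  then show ?thesis
    by (intro that[of "1 + op_norm (A x0) + op_norm (matrix_inv (A x0)) + h * d powr \<alpha>"])
      (smt (verit, best) h(1) op_norm_nonneg mult_nonneg_nonneg powr_ge_zero)+
qed (use that[of 1] in auto)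

lemma holder_GL_scaleR:
  assumes "holder_GL \<alpha> X A" "0 < c"
  shows "holder_GL \<alpha> X (\<lambda>x. c *\<^sub>R A x)"
proof -
  obtain h where h: "0 < h"
    "\<And>x y. x \<in> X \<Longrightarrow> y \<in> X \<Longrightarrow> op_norm (A x - A y) \<le> h * dist x y powr \<alpha>"
    "\<And>x y. x \<in> X \<Longrightarrow> y \<in> X \<Longrightarrow> op_norm (matrix_inv (A x) - matrix_inv (A y)) \<le> h * dist x y powr \<alpha>"
    using holder_GL_op_norm[OF assms(1)] by metis
  have inv: "matrix_inv (c *\<^sub>R A x) = (1 / c) *\<^sub>R matrix_inv (A x)" if "x \<in> X" for x
    using assms(2) matrix_inv_right[OF holder_GL_invertible[OF assms(1) that]]
    by (intro matrix_inv_eqI(2)) (simp add: matrix_scalar_ac scalar_matrix_assoc[symmetric])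
  have "dist_GL (c *\<^sub>R A x) (c *\<^sub>R A y) \<le> (c * h + (1 / c) * h) * dist x y powr \<alpha>"
    if "x \<in> X" "y \<in> X" for x y
  proof -
    have "c * op_norm (A x - A y) \<le> c * (h * dist x y powr \<alpha>)"
      "(1 / c) * op_norm (matrix_inv (A x) - matrix_inv (A y)) \<le> (1 / c) * (h * dist x y powr \<alpha>)"
      using assms(2) h(2,3)[OF that] by (intro mult_left_mono; simp)+
    moreover have "dist_GL (c *\<^sub>R A x) (c *\<^sub>R A y)
        = c * op_norm (A x - A y) + (1 / c) * op_norm (matrix_inv (A x) - matrix_inv (A y))"
      using assms(2) inv that by (simp add: dist_GL_def op_norm_scaleR flip: scaleR_diff_right)
    ultimately show ?thesis
      unfolding distrib_right mult.assoc by linarith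
  qed
  moreover have "(\<lambda>x. c *\<^sub>R A x) \<in> X \<rightarrow> GL"
    using assms by (auto simp: holder_GL_def GL_def intro!: scalar_invertible)
  ultimately show ?thesis unfolding holder_GL_def by blast
qed

lemma holder_GL_transpose_inverse:
  assumes "holder_GL \<alpha> X A"
  shows "holder_GL \<alpha> X (\<lambda>x. transpose (matrix_inv (A x)))"
proof -
  have "transpose (matrix_inv (A x)) \<in> GL"
    "matrix_inv (transpose (matrix_inv (A x))) = transpose (A x)" if "x \<in> X" for x
    using holder_GL_invertible[OF assms that]
    by (simp_all add: GL_def transpose_invertible invertible_matrix_inv matrix_inv_transpose matrix_inv_matrix_inv)
  then show ?thesis
    using assms unfolding holder_GL_def dist_GL_def
    by (simp add: Pi_iff add.commute flip: transpose_diff)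
qed

section \<open>Systems with the closing property\<close>

locale closing_system =
  fixes X :: "'a::metric_space set" and f :: "'a \<Rightarrow> 'a" and c l \<delta>\<^sub>0 :: real
  assumes compact_X: "compact X"
    and maps: "f ` X \<subseteq> X"
    and c_pos: "0 < c" and l_pos: "0 < l" and \<delta>\<^sub>0_pos: "0 < \<delta>\<^sub>0"
    and closing: "\<And>x n. x \<in> X \<Longrightarrow> 0 < n \<Longrightarrow> dist x ((f ^^ n) x) < \<delta>\<^sub>0 \<Longrightarrow>
      \<exists>p\<in>X. \<exists>y\<in>X. (f ^^ n) p = p \<and>
        (\<forall>i\<le>n. dist ((f ^^ i) x) ((f ^^ i) p) \<le> c * dist x ((f ^^ n) x) * exp (- l * real (min i (n - i)))) \<and>
        (\<forall>i\<le>n. dist ((f ^^ i) p) ((f ^^ i) y) \<le> c * dist x ((f ^^ n) x) * exp (- l * real i)) \<and>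
        (\<forall>i\<le>n. dist ((f ^^ i) y) ((f ^^ i) x) \<le> c * dist x ((f ^^ n) x) * exp (- l * real (n - i)))"

lemma closing_system_exists:
  assumes "compact X" "f ` X \<subseteq> X" "closing_property X f"
  obtains c l \<delta>\<^sub>0 where "closing_system X f c l \<delta>\<^sub>0"
proof -
  obtain c l \<delta>\<^sub>0 where pos: "c > 0" "l > 0" "\<delta>\<^sub>0 > 0"
    and cl: "\<forall>x\<in>X. \<forall>n>0. dist x ((f ^^ n) x) < \<delta>\<^sub>0 \<longrightarrow>
        (let \<delta> = c * dist x ((f ^^ n) x) in
          \<exists>p\<in>X. (f ^^ n) p = p \<and> exponentially_close f \<delta> l n x p \<and>
            (\<exists>y\<in>X. \<forall>i\<le>n.
               dist ((f ^^ i) p) ((f ^^ i) y) \<le> \<delta> * exp (- l * real i) \<and>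
               dist ((f ^^ i) y) ((f ^^ i) x) \<le> \<delta> * exp (- l * real (n - i))))"
    using assms(3) unfolding closing_property_def by auto
  have "closing_system X f c l \<delta>\<^sub>0"
  proof
    fix x n assume "x \<in> X" "0 < n" "dist x ((f ^^ n) x) < \<delta>\<^sub>0"
    with cl show "\<exists>p\<in>X. \<exists>y\<in>X. (f ^^ n) p = p \<and>
        (\<forall>i\<le>n. dist ((f ^^ i) x) ((f ^^ i) p) \<le> c * dist x ((f ^^ n) x) * exp (- l * real (min i (n - i)))) \<and>
        (\<forall>i\<le>n. dist ((f ^^ i) p) ((f ^^ i) y) \<le> c * dist x ((f ^^ n) x) * exp (- l * real i)) \<and>
        (\<forall>i\<le>n. dist ((f ^^ i) y) ((f ^^ i) x) \<le> c * dist x ((f ^^ n) x) * exp (- l * real (n - i)))"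
      unfolding Let_def exponentially_close_def by meson
  qed (use assms pos in auto)
  then show ?thesis by (rule that)
qed

text \<open>
  The number \<open>M\<close> depends on \<open>d\<close> only and not on the sequence, so that close pairs can be found among
  widely spaced times of one orbit.
\<close>

lemma pigeonhole_close:
  fixes X :: "'a::metric_space set"
  assumes "compact X" "0 < d"
  obtains M :: nat where "0 < M"
    "\<And>u. (\<And>i. u i \<in> X) \<Longrightarrow> \<exists>i j. i < j \<and> j \<le> M \<and> dist (u i) (u j) < d"
proof -
  obtain F where F: "finite F" "X \<subseteq> (\<Union>a\<in>F. ball a (d / 2))"
    using seq_compact_imp_totally_bounded[of X] assms
    by (metis compact_imp_seq_compact half_gt_zero)
  have "\<exists>i j. i < j \<and> j \<le> Suc (card F) \<and> dist (u i) (u j) < d" if u: "\<And>i. u i \<in> X" for u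
  proof -
    have "\<exists>a\<in>F. u i \<in> ball a (d / 2)" for i
      using F(2) u[of i] by blast
    then obtain g where g: "g i \<in> F" "u i \<in> ball (g i) (d / 2)" for i
      by metis
    have "\<not> inj_on g {..Suc (card F)}"
    proof
      assume "inj_on g {..Suc (card F)}"
      then have "card {..Suc (card F)} \<le> card F"
        using g(1) F(1) by (intro card_inj_on_le[of g]) auto
      then show False by simp
    qed
    then obtain i j where ij: "i < j" "j \<le> Suc (card F)" "g i = g j"
      unfolding inj_on_def by (metis atMost_iff linorder_neqE_nat)
    have "dist (u i) (u j) < d"
      using g(2)[of i] g(2)[of j] ij(3) dist_triangle_half_r[of "g i" "u i" d "u j"] by simp
    with ij show ?thesis by blast
  qed
  then show ?thesis by (intro that[of "Suc (card F)"]) auto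
qed

text \<open>
  Exponential closeness of orbits turns into exponential closeness of the matrices along them, at the rate
  \<open>l \<alpha>\<close>.
\<close>

lemma holder_close:
  assumes h: "\<And>x y. x \<in> X \<Longrightarrow> y \<in> X \<Longrightarrow> op_norm (A x - A y) \<le> h * dist x y powr \<alpha>"
    and "x \<in> X" "y \<in> X" "dist x y \<le> d * exp (- l * t)" "0 < \<alpha>" "0 \<le> d" "0 \<le> h"
  shows "op_norm (A x - A y) \<le> h * d powr \<alpha> * exp (- (l * \<alpha>) * t)"
proof -
  have "dist x y powr \<alpha> \<le> (d * exp (- l * t)) powr \<alpha>"
    using assms by (intro powr_mono2) auto
  also have "\<dots> = d powr \<alpha> * exp (- (l * \<alpha>) * t)"
    using assms by (simp add: powr_mult exp_powr_real mult_ac)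
  finally show ?thesis
    using assms(7) h[OF assms(2,3)] mult_left_mono[of "dist x y powr \<alpha>" _ h] by (fastforce simp: mult_ac)
qed

lemma op_norm_inverse_cocycle_le:
  fixes A :: "'a \<Rightarrow> real^'m^'m"
  assumes "f ` X \<subseteq> X" "A \<in> X \<rightarrow> GL" "x \<in> X"
    and "\<And>x. x \<in> X \<Longrightarrow> op_norm (matrix_inv (A x)) \<le> b" "0 \<le> b"
  shows "op_norm (matrix_inv (cocycle f A n x)) \<le> b ^ n"
proof -
  have "op_norm (matrix_inv (cocycle f A n x)) = op_norm (cocycle f (\<lambda>x. transpose (matrix_inv (A x))) n x)"
    using assms by (subst cocycle_transpose_inverse) auto
  also have "\<dots> \<le> b ^ n"
    using assms by (intro op_norm_cocycle_le[of f X]) auto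
  finally show ?thesis .
qed

context closing_system
begin

lemma funpow_mem [simp]: "x \<in> X \<Longrightarrow> (f ^^ n) x \<in> X"
  using funpow_in[OF maps] .

text \<open>
  The finitely many times below \<open>n\<^sub>0\<close> could otherwise be absorbed into the constant \<open>K\<close>.
\<close>

lemma large_product_at_large_time:
  fixes A :: "'a \<Rightarrow> real^'m^'m"
  assumes "0 < \<alpha>" "holder_GL \<alpha> X A" "0 \<le> r"
    and unbounded: "\<not> (\<exists>K. \<forall>x\<in>X. \<forall>n. op_norm (cocycle f A n x) \<le> K * exp (r * real n))"
  shows "\<exists>x\<in>X. \<exists>n\<ge>n\<^sub>0. exp (r * real n) \<le> op_norm (cocycle f A n x)"
proof (rule ccontr)
  assume "\<not> ?thesis"
  then have late: "op_norm (cocycle f A n x) \<le> exp (r * real n)" if "x \<in> X" "n \<ge> n\<^sub>0" for x n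
    using that by force
  obtain b where b: "1 \<le> b" "\<And>x. x \<in> X \<Longrightarrow> op_norm (A x) \<le> b"
    using holder_GL_bounded[OF compact_imp_bounded[OF compact_X] assms(1,2)] by metis
  have "op_norm (cocycle f A n x) \<le> b ^ n\<^sub>0 * exp (r * real n)" if "x \<in> X" for x n
  proof (cases "n \<ge> n\<^sub>0")
    case True
    have "1 * exp (r * real n) \<le> b ^ n\<^sub>0 * exp (r * real n)"
      by (intro mult_right_mono one_le_power b(1)) simp
    then show ?thesis
      using late[OF that True] by linarith
  next
    case False
    have "op_norm (cocycle f A n x) \<le> b ^ n"
      using b that by (intro op_norm_cocycle_le[OF maps]) auto
    also have "\<dots> \<le> b ^ n\<^sub>0"
      using b(1) False by (intro power_increasing) auto
    also have "\<dots> \<le> b ^ n\<^sub>0 * exp (r * real n)"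
      using b(1) assms(3) by simp
    finally show ?thesis .
  qed
  with unbounded show False by blast
qed

text \<open>
  Take a segment of length \<open>T\<close> on which the product grows at a rate within \<open>\<epsilon>\<close> of \<open>q\<close>. Up to a constant
  factor no subsegment can grow at a rate above \<open>q + \<epsilon>\<close>, so the defect of any subsegment is
  at most about \<open>2 \<epsilon> T\<close>, and every subsegment of length at least \<open>T / (2 M)\<close> grows at a rate at least \<open>q - 4 \<epsilon> M\<close>. Among \<open>M + 1\<close> times at
  distance about \<open>T / M\<close> two are spatially close by the pigeonhole principle. The constant \<open>M\<close> is given by
  \<open>d\<close>, and \<open>\<epsilon>\<close> is chosen after it.
\<close>

lemma expanding_close_return:
  fixes A :: "'a \<Rightarrow> real^'m^'m"
  assumes "0 < \<alpha>" "holder_GL \<alpha> X A" "0 < q"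
    and upper: "\<And>r. q < r \<Longrightarrow> \<exists>K. \<forall>x\<in>X. \<forall>n. op_norm (cocycle f A n x) \<le> K * exp (r * real n)"
    and lower: "\<And>r. 0 \<le> r \<Longrightarrow> r < q \<Longrightarrow> \<not> (\<exists>K. \<forall>x\<in>X. \<forall>n. op_norm (cocycle f A n x) \<le> K * exp (r * real n))"
    and "0 < d" "0 < \<tau>" "\<tau> \<le> q"
  shows "\<exists>x\<in>X. \<exists>n\<ge>n\<^sub>0. 0 < n \<and> dist x ((f ^^ n) x) < d \<and> exp ((q - \<tau>) * real n) \<le> op_norm (cocycle f A n x)"
proof -
  obtain M :: nat where M: "0 < M"
    "\<And>u. (\<And>i. u i \<in> X) \<Longrightarrow> \<exists>i j. i < j \<and> j \<le> M \<and> dist (u i) (u j) < d"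
    using pigeonhole_close[OF compact_X \<open>0 < d\<close>] by metis
  \<comment> \<open>so that the defect \<open>4 \<epsilon> M\<close> uses up half of \<open>\<tau>\<close>; the other half absorbs the constant \<open>K\<^sup>2\<close>\<close>
  define \<epsilon> where "\<epsilon> = \<tau> / (8 * real M)"
  have \<epsilon>: "0 < \<epsilon>" "\<epsilon> \<le> q" "4 * \<epsilon> * real M = \<tau> / 2"
  proof -
    show "0 < \<epsilon>" "4 * \<epsilon> * real M = \<tau> / 2"
      using M(1) assms(7) by (auto simp: \<epsilon>_def)
    have "\<epsilon> \<le> \<tau> / 1"
      unfolding \<epsilon>_def using M(1) assms(7) by (intro frac_le) auto
    then show "\<epsilon> \<le> q" using assms(8) by simp
  qed
  obtain K0 where K0: "op_norm (cocycle f A n x) \<le> K0 * exp ((q + \<epsilon>) * real n)" if "x \<in> X" for x n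
    using upper[of "q + \<epsilon>"] \<epsilon> by auto
  define K where "K = max K0 1"
  have Kx: "1 \<le> K" by (simp add: K_def)
  have K: "op_norm (cocycle f A n x) \<le> K * exp ((q + \<epsilon>) * real n)" if "x \<in> X" for x n
    by (rule order_trans[OF K0[OF that]]) (simp add: K_def mult_right_mono)
  define w\<^sub>0 where "w\<^sub>0 = max (max n\<^sub>0 1) (nat \<lceil>4 * ln K / \<tau>\<rceil>)"
  obtain x T where x: "x \<in> X" and T: "T \<ge> M * w\<^sub>0"
    and big: "exp ((q - \<epsilon>) * real T) \<le> op_norm (cocycle f A T x)"
    using large_product_at_large_time[OF assms(1,2) _ lower, of "q - \<epsilon>" "M * w\<^sub>0"] \<epsilon> by auto
  define w where "w = T div M"
  have w: "w\<^sub>0 \<le> w"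
    using T M(1) by (simp add: w_def less_eq_div_iff_mult_less_eq mult.commute)
  have w1: "1 \<le> w" "n\<^sub>0 \<le> w" and w2: "4 * ln K / \<tau> \<le> real w"
    using w by (auto simp: w\<^sub>0_def)
  obtain i j where ij: "i < j" "j \<le> M" "dist ((f ^^ (i * w)) x) ((f ^^ (j * w)) x) < d"
    using M(2)[of "\<lambda>i. (f ^^ (i * w)) x"] x by auto
  define a n where "a = i * w" and "n = (j - i) * w"
  have n: "w \<le> n" "a + n = j * w"
    using ij(1) by (auto simp: n_def a_def simp flip: add_mult_distrib)
  have "T mod M < M" "T = M * w + T mod M" using M(1) by (auto simp: w_def)
  then have "T \<le> M * w + M" by linarith
  also have "\<dots> \<le> 2 * M * w" using w1(1) by simp
  also have "\<dots> \<le> 2 * M * n" using n(1) by simp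
  finally have "real T \<le> real (2 * M * n)" by linarith
  then have "\<epsilon> * real T * 2 \<le> \<epsilon> * real (2 * M * n) * 2"
    using \<epsilon>(1) by simp
  also have "\<dots> = (4 * \<epsilon> * real M) * real n" by simp
  finally have Tn: "\<epsilon> * real T * 2 \<le> \<tau> / 2 * real n" unfolding \<epsilon>(3) .
  have jwT: "a + n \<le> T"
    using n(2) ij(2) mult_le_mono1[of j M w] times_div_less_eq_dividend[of M T]
    unfolding w_def by linarith
  have lnK: "2 * ln K \<le> \<tau> / 2 * real n"
  proof -
    have "4 * ln K / \<tau> \<le> real n" using w2 n(1) by linarith
    then show ?thesis using assms(7) by (simp add: field_simps)
  qed
  let ?y = "(f ^^ a) x"
  let ?F = "op_norm (cocycle f A n ?y)"
  have fan: "(f ^^ n) ?y = (f ^^ (a + n)) x"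
    by (simp add: funpow_add add.commute[of a n])
  have "cocycle f A T x = cocycle f A (T - (a + n)) ((f ^^ (a + n)) x) ** cocycle f A n ?y ** cocycle f A a x"
    using jwT cocycle_split[of "a + n" T f A x] cocycle_add[of f A n a x] by (simp add: add.commute matrix_mul_assoc)
  then have "exp ((q - \<epsilon>) * real T) \<le> op_norm (cocycle f A (T - (a + n)) ((f ^^ (a + n)) x)) * ?F * op_norm (cocycle f A a x)"
    using big op_norm_mult3 order_trans by metis
  also have "\<dots> \<le> (K * exp ((q + \<epsilon>) * real (T - (a + n)))) * ?F * (K * exp ((q + \<epsilon>) * real a))"
    using x Kx by (intro mult_mono K) auto
  also have "\<dots> = exp (2 * ln K + (q + \<epsilon>) * (real T - real n)) * ?F"
  proof -
    have "exp (ln K) * exp ((q + \<epsilon>) * real (T - (a + n))) * (exp (ln K) * exp ((q + \<epsilon>) * real a))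
        = exp (2 * ln K + (q + \<epsilon>) * (real T - real n))"
      using jwT by (simp add: of_nat_diff algebra_simps flip: exp_add)
    then show ?thesis
      using Kx by (simp add: mult_ac)
  qed
  also have "\<dots> \<le> exp (\<tau> / 2 * real n + (q + \<epsilon>) * (real T - real n)) * ?F"
    using lnK by (intro mult_right_mono) auto
  finally have "exp ((q - \<epsilon>) * real T) \<le> exp (\<tau> / 2 * real n + (q + \<epsilon>) * (real T - real n)) * ?F" .
  then have "exp ((q - \<epsilon>) * real T - (\<tau> / 2 * real n + (q + \<epsilon>) * (real T - real n))) \<le> ?F"
    by (subst exp_diff) (simp add: pos_divide_le_eq mult.commute)
  moreover have "(q - \<tau>) * real n \<le> (q - \<epsilon>) * real T - (\<tau> / 2 * real n + (q + \<epsilon>) * (real T - real n))"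
  proof -
    have "0 \<le> \<epsilon> * real n" using \<epsilon>(1) by simp
    then show ?thesis
      using Tn unfolding left_diff_distrib right_diff_distrib distrib_right by linarith
  qed
  ultimately have "exp ((q - \<tau>) * real n) \<le> ?F"
    using order_trans[OF iffD2[OF exp_le_cancel_iff]] by blast
  moreover have "dist ?y ((f ^^ n) ?y) < d"
    using ij(3) unfolding fan n(2) unfolding a_def .
  ultimately show ?thesis
    using x w1 n(1) by (intro bexI[of _ ?y] exI[of _ n]) auto
qed

text \<open>
  If the cocycle has top exponent \<open>q > 0\<close> and \<open>q\<close> is small against the rate \<open>l \<alpha>\<close> in the closing property,
  an expanding segment that nearly returns is shadowed by a periodic orbit, and one would like to say that
  the product along the latter expands as well. The perturbation lemma needs a segment whose product is
  maximal among its subsegments, so the returning segment is first trimmed at both ends to such a subsegment.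
  Since the whole segment already grows almost at the top rate, only a small proportion of it is trimmed.
  On the trimmed segment the shadowing estimate is even better, and the loss over the trimmed ends is
  controlled by the crude bound \<open>b\<close> for the inverses, which is harmless because the ends are short.
\<close>

lemma expanding_periodic_orbit:
  fixes A :: "'a \<Rightarrow> real^'m^'m"
  assumes "0 < \<alpha>" "holder_GL \<alpha> X A" "0 < q" "2 * q < l * \<alpha>"
    and upper: "\<And>r. q < r \<Longrightarrow> \<exists>K. \<forall>x\<in>X. \<forall>n. op_norm (cocycle f A n x) \<le> K * exp (r * real n)"
    and lower: "\<And>r. 0 \<le> r \<Longrightarrow> r < q \<Longrightarrow> \<not> (\<exists>K. \<forall>x\<in>X. \<forall>n. op_norm (cocycle f A n x) \<le> K * exp (r * real n))"
  shows "\<exists>p\<in>X. \<exists>n>0. (f ^^ n) p = p \<and> 1 < op_norm (cocycle f A n p)"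
proof -
  have GL: "A \<in> X \<rightarrow> GL" using assms(2) by (simp add: holder_GL_def)
  obtain h where h: "0 < h" "\<And>x y. x \<in> X \<Longrightarrow> y \<in> X \<Longrightarrow> op_norm (A x - A y) \<le> h * dist x y powr \<alpha>"
    using holder_GL_op_norm[OF assms(2)] by metis
  obtain b where b: "1 \<le> b" "\<And>x. x \<in> X \<Longrightarrow> op_norm (matrix_inv (A x)) \<le> b"
    using holder_GL_bounded[OF compact_imp_bounded[OF compact_X] assms(1,2)] by metis
  define L where "L = ln b"
  have L: "0 \<le> L" "b ^ k = exp (L * real k)" for k
    using b(1) by (simp_all add: L_def exp_of_nat2_mult)
  define \<eta> where "\<eta> = l * \<alpha>"
  obtain K0 where K0: "op_norm (cocycle f A n x) \<le> K0 * exp (2 * q * real n)" if "x \<in> X" for x n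
    using upper[of "2 * q"] assms(3) by auto
  define K where "K = max K0 1"
  have K: "1 \<le> K" by (simp add: K_def)
  have growth: "op_norm (cocycle f A n x) \<le> K * exp (2 * q * real n)" if "x \<in> X" for x n
    by (rule order_trans[OF K0[OF that]]) (simp add: K_def mult_right_mono)
  \<comment> \<open>the closing distance below which the perturbation lemma applies\<close>
  define \<theta> where "\<theta> = (1 - exp (- (\<eta> - 2 * q))) / (8 * K)"
  have \<theta>: "0 < \<theta>" "8 * K * \<theta> \<le> 1 - exp (- (\<eta> - 2 * q))"
    using K assms(4) by (simp_all add: \<theta>_def \<eta>_def)
  define d\<^sub>0 where "d\<^sub>0 = (\<theta> / h) powr (1 / \<alpha>)"
  have d\<^sub>0: "0 < d\<^sub>0" "h * d\<^sub>0 powr \<alpha> = \<theta>"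
    using \<theta>(1) h(1) assms(1) by (simp_all add: d\<^sub>0_def powr_powr)
  define d where "d = min \<delta>\<^sub>0 (d\<^sub>0 / c)"
  have d: "0 < d" using d\<^sub>0 c_pos \<delta>\<^sub>0_pos by (simp add: d_def)
  \<comment> \<open>chosen so that \<open>\<tau> + 3 L \<tau> / q = q / 2\<close>: trimming costs at most half of the expansion\<close>
  define D where "D = 1 + 3 * L / q"
  have D: "1 \<le> D" using L assms(3) by (simp add: D_def)
  define \<tau> where "\<tau> = q / (2 * D)"
  have \<tau>: "0 < \<tau>" "\<tau> \<le> q" "\<tau> * D = q / 2"
    using assms(3) D mult_left_mono[of 1 "2 * D" q] by (simp_all add: \<tau>_def divide_le_eq)
  obtain K1 where K1: "op_norm (cocycle f A n x) \<le> K1 * exp ((q + \<tau>) * real n)" if "x \<in> X" for x n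
    using upper[of "q + \<tau>"] \<tau> by auto
  define n\<^sub>0 where "n\<^sub>0 = max (nat \<lceil>2 / q\<rceil>) (nat \<lceil>ln (max K1 1) / \<tau>\<rceil>)"
  obtain x n where x: "x \<in> X" and n: "n\<^sub>0 \<le> n" "0 < n" and ret: "dist x ((f ^^ n) x) < d"
    and exp_n: "exp ((q - \<tau>) * real n) \<le> op_norm (cocycle f A n x)"
    using expanding_close_return[OF assms(1-3) upper lower d \<tau>(1,2), of n\<^sub>0] by blast
  have "2 / q \<le> real n" "ln (max K1 1) / \<tau> \<le> real n"
    using n(1) by (simp_all add: n\<^sub>0_def)
  then have n2: "2 \<le> q * real n" and n1: "ln (max K1 1) \<le> \<tau> * real n"
    using assms(3) \<tau>(1) by (simp_all add: field_simps)
  have K1n: "K1 \<le> exp (\<tau> * real n)"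
  proof -
    have "K1 \<le> exp (ln (max K1 1))" by simp
    also have "\<dots> \<le> exp (\<tau> * real n)" using n1 by (simp only: exp_le_cancel_iff)
    finally show ?thesis .
  qed
  \<comment> \<open>trim the segment to a subsegment \<open>u, \<dots>, u + k\<close> with the largest product\<close>
  let ?S = "{(u, k). u + k \<le> n}"
  let ?G = "\<lambda>(u, k). op_norm (cocycle f A k ((f ^^ u) x))"
  have fin: "finite (?G ` ?S)"
    by (intro finite_imageI finite_subset[of ?S "{..n} \<times> {..n}"]) auto
  moreover have "(0, 0) \<in> ?S" by simp
  then have "?G ` ?S \<noteq> {}" by blast
  ultimately have "Max (?G ` ?S) \<in> ?G ` ?S" by (rule Max_in)
  then obtain s where s: "s \<in> ?S" "Max (?G ` ?S) = ?G s" by (rule imageE)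
  obtain u k where uk: "u + k \<le> n"
    and max: "\<And>i j. i + j \<le> n \<Longrightarrow> op_norm (cocycle f A j ((f ^^ i) x)) \<le> op_norm (cocycle f A k ((f ^^ u) x))"
  proof -
    obtain u k where uk: "s = (u, k)" by (cases s)
    have "op_norm (cocycle f A j ((f ^^ i) x)) \<le> op_norm (cocycle f A k ((f ^^ u) x))" if "i + j \<le> n" for i j
      using Max_ge[OF fin, of "?G (i, j)"] imageI[of "(i, j)" ?S ?G] that s(2) by (simp add: uk)
    with s(1) show ?thesis by (intro that[of u k]) (auto simp: uk)
  qed
  define N where "N = op_norm (cocycle f A k ((f ^^ u) x))"
  have N_ge: "exp ((q - \<tau>) * real n) \<le> N"
    using exp_n max[of 0 n] by (simp add: N_def)
  have trim: "q * real (n - k) \<le> 3 * \<tau> * real n"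
  proof -
    have "N \<le> K1 * exp ((q + \<tau>) * real k)"
      using K1[of "(f ^^ u) x" k] x by (simp add: N_def)
    also have "\<dots> \<le> exp (\<tau> * real n) * exp ((q + \<tau>) * real k)"
      using K1n by (intro mult_right_mono) auto
    finally have "exp ((q - \<tau>) * real n) \<le> exp (\<tau> * real n + (q + \<tau>) * real k)"
      using N_ge by (simp add: exp_add)
    then have "(q - \<tau>) * real n \<le> \<tau> * real n + (q + \<tau>) * real k"
      by (simp only: exp_le_cancel_iff)
    moreover have "\<tau> * real k \<le> \<tau> * real n"
      using uk \<tau>(1) by simp
    ultimately show ?thesis
      using uk by (simp add: of_nat_diff algebra_simps)
  qed
  obtain p where p: "p \<in> X" "(f ^^ n) p = p"
    and close: "\<And>i. i \<le> n \<Longrightarrow> dist ((f ^^ i) x) ((f ^^ i) p) \<le> c * dist x ((f ^^ n) x) * exp (- l * real (min i (n - i)))"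
    using closing[OF x n(2)] ret unfolding d_def by auto
  have N_half: "N / 2 \<le> op_norm (cocycle f A k ((f ^^ u) p))"
  proof -
    have "op_norm (cocycle f A k ((f ^^ u) p) - cocycle f A k ((f ^^ u) x)) \<le> N / 2"
    proof (rule cocycle_perturbation[where K = K and q = "2 * q" and \<theta> = \<theta> and \<eta> = \<eta>])
      show "op_norm (cocycle f A j ((f ^^ i) ((f ^^ u) x))) \<le> N" if "i + j \<le> k" for i j
        using max[of "i + u" j] that uk by (simp add: N_def funpow_add)
      show "op_norm (A ((f ^^ i) ((f ^^ u) p)) - A ((f ^^ i) ((f ^^ u) x))) \<le> \<theta> * exp (- \<eta> * real (min i (k - i)))"
        if "i < k" for i
      proof -
        have "c * dist x ((f ^^ n) x) \<le> d\<^sub>0"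
          using ret c_pos by (simp add: d_def field_simps)
        moreover have "exp (- l * real (min (i + u) (n - (i + u)))) \<le> exp (- l * real (min i (k - i)))"
        proof -
          have "min i (k - i) \<le> min (i + u) (n - (i + u))"
            using that uk by arith
          then have "l * real (min i (k - i)) \<le> l * real (min (i + u) (n - (i + u)))"
            using l_pos by (intro mult_left_mono) (auto simp only: of_nat_le_iff)
          then show ?thesis by simp
        qed
        ultimately have "c * dist x ((f ^^ n) x) * exp (- l * real (min (i + u) (n - (i + u))))
            \<le> d\<^sub>0 * exp (- l * real (min i (k - i)))"
          using d\<^sub>0(1) by (intro mult_mono) auto
        then have "dist ((f ^^ (i + u)) x) ((f ^^ (i + u)) p) \<le> d\<^sub>0 * exp (- l * real (min i (k - i)))"
          using close[of "i + u"] that uk by linarith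
        then have "op_norm (A ((f ^^ (i + u)) p) - A ((f ^^ (i + u)) x)) \<le> h * d\<^sub>0 powr \<alpha> * exp (- (l * \<alpha>) * real (min i (k - i)))"
          using h x p d\<^sub>0(1) assms(1) by (intro holder_close[where X = X]) (auto simp: dist_commute)
        then show ?thesis
          by (simp add: d\<^sub>0(2) \<eta>_def funpow_add)
      qed
    qed (use growth x p assms(3,4) \<theta> in \<open>auto simp: \<eta>_def\<close>)
    then show ?thesis
      using op_norm_triangle_le_add_diff[of "cocycle f A k ((f ^^ u) x)" "cocycle f A k ((f ^^ u) p)"]
        op_norm_minus_commute[of "cocycle f A k ((f ^^ u) x)"] by (simp add: N_def)
  qed
  \<comment> \<open>the trimmed ends cost at most the factor \<open>b ^ (n - k)\<close>\<close>
  let ?P1 = "cocycle f A u p" and ?P2 = "cocycle f A k ((f ^^ u) p)"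
    and ?P3 = "cocycle f A (n - (u + k)) ((f ^^ (u + k)) p)" and ?P = "cocycle f A n p"
  have inv: "invertible ?P1" "invertible ?P3"
    using p(1) by (auto intro!: invertible_cocycle[OF maps GL])
  have "?P = ?P3 ** (?P2 ** ?P1)"
    using cocycle_split[OF uk, of f A p] cocycle_add[of f A k u p] by (simp add: add.commute)
  then have "matrix_inv ?P3 ** ?P ** matrix_inv ?P1 = (matrix_inv ?P3 ** ?P3) ** ?P2 ** (?P1 ** matrix_inv ?P1)"
    by (simp only: matrix_mul_assoc)
  then have "?P2 = matrix_inv ?P3 ** ?P ** matrix_inv ?P1"
    using inv by (simp add: matrix_inv_left matrix_inv_right)
  then have "op_norm ?P2 \<le> op_norm (matrix_inv ?P3) * op_norm ?P * op_norm (matrix_inv ?P1)"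
    by (simp only: op_norm_mult3)
  then have "N / 2 \<le> op_norm (matrix_inv ?P3) * op_norm ?P * op_norm (matrix_inv ?P1)"
    using N_half by (rule order_trans[rotated])
  also have "\<dots> \<le> b ^ (n - (u + k)) * op_norm ?P * b ^ u"
    using p(1) b by (intro mult_mono op_norm_inverse_cocycle_le[OF maps GL]) auto
  also have "\<dots> = exp (L * real (n - k)) * op_norm ?P"
    using uk by (simp add: L(2) of_nat_diff algebra_simps flip: exp_add)
  finally have 1: "N / 2 \<le> exp (L * real (n - k)) * op_norm ?P" .
  have "L * real (n - k) \<le> 3 * L / q * \<tau> * real n"
    using mult_left_mono[OF trim L(1)] assms(3) by (simp add: field_simps)
  then have "L * real (n - k) + 1 \<le> (q - \<tau>) * real n"
  proof -
    have "\<tau> * real n + 3 * L / q * \<tau> * real n = \<tau> * D * real n"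
      by (simp add: D_def algebra_simps)
    also have "\<dots> = q / 2 * real n" unfolding \<tau>(3) ..
    finally show ?thesis
      using \<open>L * real (n - k) \<le> 3 * L / q * \<tau> * real n\<close> n2 by (simp add: left_diff_distrib)
  qed
  then have "exp (L * real (n - k) + 1) \<le> N"
    using N_ge by (meson exp_le_cancel_iff order_trans)
  then have "exp (L * real (n - k)) * (exp 1 / 2) \<le> exp (L * real (n - k)) * op_norm ?P"
    using 1 unfolding exp_add by linarith
  then have "exp 1 / 2 \<le> op_norm ?P"
    by (rule mult_left_le_imp_le) simp
  moreover have "2 < exp (1::real)"
    using exp_lower_Taylor_quadratic[of "1::real"] by simp
  ultimately have "1 < op_norm ?P" by simp
  with p n(2) show ?thesis by blast
qed

text \<open>
  Let \<open>\<Lambda>\<close> be the top exponent. If \<open>\<Lambda> > 0\<close>, multiplying the cocycle by a positive constant at most one makes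
  its top exponent positive and as small as desired; then some periodic product of the scaled cocycle has norm
  above one, although it is a multiple of the identity by a factor at most one.
\<close>

lemma subexponential_growth:
  fixes A :: "'a \<Rightarrow> real^'m^'m"
  assumes "0 < \<alpha>" "holder_GL \<alpha> X A"
    and periodic: "\<And>p n. p \<in> X \<Longrightarrow> 0 < n \<Longrightarrow> (f ^^ n) p = p \<Longrightarrow> cocycle f A n p = mat 1"
    and "0 < r"
  shows "\<exists>K. \<forall>x\<in>X. \<forall>n. op_norm (cocycle f A n x) \<le> K * exp (r * real n)"
proof -
  define bounded_at where "bounded_at r \<longleftrightarrow> (\<exists>K. \<forall>x\<in>X. \<forall>n. op_norm (cocycle f A n x) \<le> K * exp (r * real n))" for r
  have mono: "bounded_at t" if "bounded_at s" "s \<le> t" for s t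
  proof -
    obtain K where K: "op_norm (cocycle f A n x) \<le> K * exp (s * real n)" if "x \<in> X" for x n
      using \<open>bounded_at s\<close> unfolding bounded_at_def by blast
    have "op_norm (cocycle f A n x) \<le> max K 0 * exp (t * real n)" if "x \<in> X" for x n
      using \<open>s \<le> t\<close> by (intro order_trans[OF K[OF that]] mult_mono) (auto intro: mult_right_mono)
    then show ?thesis unfolding bounded_at_def by blast
  qed
  define R where "R = {s. 0 \<le> s \<and> bounded_at s}"
  obtain b where b: "1 \<le> b" "\<And>x. x \<in> X \<Longrightarrow> op_norm (A x) \<le> b"
    using holder_GL_bounded[OF compact_imp_bounded[OF compact_X] assms(1,2)] by metis
  have exp_bound: "op_norm (cocycle f A n x) \<le> 1 * exp (ln b * real n)" if "x \<in> X" for x n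
    using op_norm_cocycle_le[of f X x A b n] maps that b by (simp add: exp_of_nat2_mult)
  have "bounded_at (ln b)"
    unfolding bounded_at_def using exp_bound by blast
  then have "ln b \<in> R"
    using b(1) by (simp add: R_def)
  then have R: "R \<noteq> {}" "bdd_below R"
    by (auto simp: R_def intro: bdd_belowI)
  define \<Lambda> where "\<Lambda> = Inf R"
  have above: "bounded_at s" if "\<Lambda> < s" for s
    using that R cInf_less_iff[of R s] mono by (auto simp: \<Lambda>_def R_def)
  have below: "\<not> bounded_at s" if "0 \<le> s" "s < \<Lambda>" for s
    using that R(2) cInf_lower[of s R] by (auto simp: \<Lambda>_def R_def)
  have "\<Lambda> < r"
  proof (rule ccontr)
    assume "\<not> \<Lambda> < r"
    with \<open>0 < r\<close> have \<Lambda>: "0 < \<Lambda>" by simp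
    \<comment> \<open>scale the cocycle so that its exponent becomes small compared with the contraction in the closing property\<close>
    define q where "q = min \<Lambda> (l * \<alpha> / 4)"
    have la: "0 < l * \<alpha>" using l_pos assms(1) by simp
    have q: "0 < q" "2 * q < l * \<alpha>" "q \<le> \<Lambda>"
    proof -
      have "q \<le> l * \<alpha> / 4" by (simp add: q_def)
      then show "2 * q < l * \<alpha>" using la by linarith
    qed (use \<Lambda> la in \<open>simp_all add: q_def\<close>)
    define B where "B = (\<lambda>x. exp (q - \<Lambda>) *\<^sub>R A x)"
    have B: "cocycle f B n x = exp ((q - \<Lambda>) * real n) *\<^sub>R cocycle f A n x" for n x
      unfolding B_def by (simp add: cocycle_scaleR exp_of_nat2_mult)
    have bounded_B: "(\<exists>K. \<forall>x\<in>X. \<forall>n. op_norm (cocycle f B n x) \<le> K * exp (s * real n)) \<longleftrightarrow> bounded_at (s + \<Lambda> - q)" for s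
    proof -
      have "op_norm (cocycle f B n x) \<le> K * exp (s * real n) \<longleftrightarrow>
          op_norm (cocycle f A n x) \<le> K * exp ((s + \<Lambda> - q) * real n)" for K n x
      proof -
        have eq: "K * exp (s * real n) = exp ((q - \<Lambda>) * real n) * (K * exp ((s + \<Lambda> - q) * real n))"
          by (simp add: algebra_simps flip: exp_add)
        show ?thesis
          unfolding B op_norm_scaleR eq abs_exp_cancel by (rule mult_le_cancel_left_pos) simp
      qed
      then show ?thesis unfolding bounded_at_def by simp
    qed
    have "\<exists>p\<in>X. \<exists>n>0. (f ^^ n) p = p \<and> 1 < op_norm (cocycle f B n p)"
    proof (rule expanding_periodic_orbit[OF assms(1) _ q(1,2)])
      show "holder_GL \<alpha> X B"
        unfolding B_def using assms(2) by (rule holder_GL_scaleR) simp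
      show "\<exists>K. \<forall>x\<in>X. \<forall>n. op_norm (cocycle f B n x) \<le> K * exp (s * real n)" if "q < s" for s
        unfolding bounded_B using that by (intro above) simp
      show "\<not> (\<exists>K. \<forall>x\<in>X. \<forall>n. op_norm (cocycle f B n x) \<le> K * exp (s * real n))" if "0 \<le> s" "s < q" for s
        unfolding bounded_B using that q by (intro below) simp_all
    qed
    then obtain p n where p: "p \<in> X" "0 < n" "(f ^^ n) p = p" "1 < op_norm (cocycle f B n p)"
      by blast
    then have "op_norm (cocycle f B n p) = exp ((q - \<Lambda>) * real n)"
      using periodic[OF p(1-3)] by (simp add: B op_norm_scaleR)
    moreover have "(q - \<Lambda>) * real n \<le> 0"
      using q(3) by (simp add: mult_nonpos_nonneg)
    ultimately show False using p(4) by simp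
  qed
  then show ?thesis using above unfolding bounded_at_def by blast
qed

end

section \<open>Returns of an orbit\<close>

context closing_system
begin

text \<open>
  Let \<open>p\<close> and \<open>y\<close> be as in the closing property for the segment from \<open>x\<close> to \<open>f\<^sup>n x\<close>. The products along \<open>y\<close>
  and \<open>p\<close> are compared by conjugating each error with the product up to its time, since the errors decay
  forwards; the products along \<open>x\<close> and \<open>y\<close> are compared by conjugating with the product after it, since
  there the errors decay backwards. Each conjugation costs a factor \<open>exp (2 r i)\<close>, or \<open>exp (2 r (n - i))\<close>, because
  the cocycle and its inverse both grow subexponentially, and this is beaten by the decay. The intermediate
  point \<open>y\<close> separates the two ends of the segment: the orbits of \<open>x\<close> and \<open>p\<close> differ noticeably at both of them,
  and each conjugation costs a factor \<open>exp (2 r n)\<close> at one of the ends.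
\<close>

lemma cocycle_near_one_on_return:
  fixes A :: "'a \<Rightarrow> real^'m^'m"
  assumes "0 < \<alpha>" "holder_GL \<alpha> X A"
    and periodic: "\<And>p n. p \<in> X \<Longrightarrow> 0 < n \<Longrightarrow> (f ^^ n) p = p \<Longrightarrow> cocycle f A n p = mat 1"
  obtains Q where "0 \<le> Q"
    "\<And>x n. x \<in> X \<Longrightarrow> 0 < n \<Longrightarrow> dist x ((f ^^ n) x) < \<delta>\<^sub>0 \<Longrightarrow>
      op_norm (cocycle f A n x - mat 1) \<le> Q * dist x ((f ^^ n) x) powr \<alpha>"
proof -
  let ?\<eta> = "l * \<alpha>"
  \<comment> \<open>a growth rate for which the conjugations cost only half of the decay rate \<open>l \<alpha>\<close>\<close>
  define r where "r = ?\<eta> / 4"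
  define k where "k = ?\<eta> - 2 * r"
  have \<eta>: "0 < ?\<eta>" using l_pos assms(1) by simp
  have r: "0 < r" and k: "0 < k" using \<eta> unfolding r_def k_def by linarith+
  have GL: "A \<in> X \<rightarrow> GL" using assms(2) by (simp add: holder_GL_def)
  obtain h where h: "0 < h" "\<And>x y. x \<in> X \<Longrightarrow> y \<in> X \<Longrightarrow> op_norm (A x - A y) \<le> h * dist x y powr \<alpha>"
    using holder_GL_op_norm[OF assms(2)] by metis
  let ?T = "\<lambda>x. transpose (matrix_inv (A x))"
  obtain K1 where K1: "op_norm (cocycle f A n x) \<le> K1 * exp (r * real n)" if "x \<in> X" for x n
    using subexponential_growth[OF assms r] by blast
  have "cocycle f ?T n p = mat 1" if "p \<in> X" "0 < n" "(f ^^ n) p = p" for p n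
    using that by (simp add: cocycle_transpose_inverse[OF maps GL] periodic)
  then obtain K2 where K2: "op_norm (cocycle f ?T n x) \<le> K2 * exp (r * real n)" if "x \<in> X" for x n
    using subexponential_growth[OF assms(1) holder_GL_transpose_inverse[OF assms(2)] _ r] by blast
  define K where "K = max 1 (max K1 K2)"
  have K: "1 \<le> K" by (simp add: K_def)
  have growth: "op_norm (cocycle f A n x) \<le> K * exp (r * real n)" if "x \<in> X" for x n
    by (rule order_trans[OF K1[OF that]]) (simp add: K_def mult_right_mono)
  have growth_inv: "op_norm (matrix_inv (cocycle f A n x)) \<le> K * exp (r * real n)" if "x \<in> X" for x n
  proof -
    have "op_norm (matrix_inv (cocycle f A n x)) = op_norm (cocycle f ?T n x)"
      by (simp add: cocycle_transpose_inverse[OF maps GL that])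
    also have "\<dots> \<le> K * exp (r * real n)"
      by (rule order_trans[OF K2[OF that]]) (simp add: K_def mult_right_mono)
    finally show ?thesis .
  qed
  define S where "S = K * K * exp r / (1 - exp (- k))"
  have S: "0 \<le> S" using K k by (simp add: S_def)
  define Q where "Q = S * (h * c powr \<alpha>) * (2 + S * (h * c powr \<alpha> * \<delta>\<^sub>0 powr \<alpha>))"
  have "op_norm (cocycle f A n x - mat 1) \<le> Q * dist x ((f ^^ n) x) powr \<alpha>"
    if x: "x \<in> X" and n: "0 < n" and ret: "dist x ((f ^^ n) x) < \<delta>\<^sub>0" for x n
  proof -
    define d where "d = c * dist x ((f ^^ n) x)"
    define \<theta> where "\<theta> = h * d powr \<alpha>"
    have d: "0 \<le> d" using c_pos by (simp add: d_def)
    have \<theta>: "0 \<le> \<theta>" using h(1) by (simp add: \<theta>_def)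
    obtain p y where p: "p \<in> X" "(f ^^ n) p = p" and y: "y \<in> X"
      and py: "\<And>i. i \<le> n \<Longrightarrow> dist ((f ^^ i) p) ((f ^^ i) y) \<le> d * exp (- l * real i)"
      and yx: "\<And>i. i \<le> n \<Longrightarrow> dist ((f ^^ i) y) ((f ^^ i) x) \<le> d * exp (- l * real (n - i))"
      using closing[OF x n ret] unfolding d_def by blast
    have inv: "invertible (cocycle f A i w)" if "w \<in> X" for i w
      using invertible_cocycle[OF maps GL that] .
    have dist_py: "op_norm (A ((f ^^ i) y) - A ((f ^^ i) p)) \<le> \<theta> * exp (- ?\<eta> * real i)" if "i \<le> n" for i
      unfolding \<theta>_def using py[OF that] p y h d assms(1)
      by (intro holder_close[where X = X]) (auto simp: dist_commute)
    have dist_yx: "op_norm (A ((f ^^ i) y) - A ((f ^^ i) x)) \<le> \<theta> * exp (- ?\<eta> * real (n - i))" if "i \<le> n" for i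
      unfolding \<theta>_def using yx[OF that] x y h d assms(1)
      by (intro holder_close[where X = X]) auto
    let ?Y = "cocycle f A n y"
    have Y: "op_norm (?Y - mat 1) \<le> S * \<theta>"
    proof -
      have "op_norm (cocycle f A (n - Suc i) ((f ^^ Suc i) p) ** (A ((f ^^ i) y) - A ((f ^^ i) p)) ** cocycle f A i y)
          \<le> K * K * exp r * \<theta> * exp (- k * real i)" if "i < n" for i
      proof -
        have "cocycle f A (n - Suc i) ((f ^^ Suc i) p) ** cocycle f A (Suc i) p = mat 1"
          using cocycle_split[of "Suc i" n f A p] that periodic[OF p(1) n p(2)] by simp
        then have *: "cocycle f A (n - Suc i) ((f ^^ Suc i) p) = matrix_inv (cocycle f A (Suc i) p)"
          using matrix_inv_eqI(2) matrix_left_right_inverse by metis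
        have "op_norm (matrix_inv (cocycle f A (Suc i) p) ** (A ((f ^^ i) y) - A ((f ^^ i) p)) ** cocycle f A i y)
            \<le> (K * exp (r * real (Suc i))) * (\<theta> * exp (- ?\<eta> * real i)) * (K * exp (r * real i))"
          using that p(1) y K \<theta> dist_py[of i] growth[OF y, of i] growth_inv[OF p(1), of "Suc i"]
          by (intro order_trans[OF op_norm_mult3] mult_mono) (auto simp del: cocycle.simps)
        also have "\<dots> = K * K * exp r * \<theta> * exp (- k * real i)"
          by (simp add: k_def algebra_simps flip: exp_add)
        finally show ?thesis unfolding * .
      qed
      then have "op_norm (?Y - mat 1) \<le> (\<Sum>i<n. K * K * exp r * \<theta> * exp (- k * real i))"
        using cocycle_diff[of f A n y p] periodic[OF p(1) n p(2)]
        by (auto intro!: order_trans[OF op_norm_sum] sum_mono simp del: funpow.simps)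
      also have "\<dots> = K * K * exp r * \<theta> * (\<Sum>i<n. exp (- k * real i))"
        by (simp only: sum_distrib_left)
      also have "\<dots> \<le> K * K * exp r * \<theta> * (1 / (1 - exp (- k)))"
        using K \<theta> k by (intro mult_left_mono sum_exp_le) auto
      finally show ?thesis by (simp add: S_def)
    qed
    have XY: "op_norm ((?Y - cocycle f A n x) ** matrix_inv ?Y) \<le> S * \<theta>"
    proof -
      have "op_norm (cocycle f A (n - Suc i) ((f ^^ Suc i) x) ** (A ((f ^^ i) y) - A ((f ^^ i) x)) ** cocycle f A i y ** matrix_inv ?Y)
          \<le> K * K * exp r * \<theta> * exp (- k * real (n - i))" (is "op_norm (?P ** ?E ** ?R ** _) \<le> _") if "i < n" for i
      proof -
        have "?R ** matrix_inv ?Y = ?R ** (matrix_inv ?R ** matrix_inv (cocycle f A (n - i) ((f ^^ i) y)))"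
          using that y cocycle_split[of i n f A y] by (simp add: matrix_inv_mult inv)
        then have "?R ** matrix_inv ?Y = matrix_inv (cocycle f A (n - i) ((f ^^ i) y))"
          using y by (simp add: matrix_mul_assoc matrix_inv_right inv)
        then have *: "?P ** ?E ** ?R ** matrix_inv ?Y = ?P ** ?E ** matrix_inv (cocycle f A (n - i) ((f ^^ i) y))"
          by (metis matrix_mul_assoc)
        have "op_norm (?P ** ?E ** matrix_inv (cocycle f A (n - i) ((f ^^ i) y)))
            \<le> (K * exp (r * real (n - i))) * (\<theta> * exp (- ?\<eta> * real (n - i))) * (K * exp (r * real (n - i)))"
        proof -
          have "op_norm ?P \<le> K * exp (r * real (n - Suc i))"
            using x by (intro growth funpow_mem)
          also have "\<dots> \<le> K * exp (r * real (n - i))"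
            using K r by (intro mult_left_mono) auto
          finally show ?thesis
            using that y K \<theta> dist_yx[of i] growth_inv[of "(f ^^ i) y" "n - i"]
            by (intro order_trans[OF op_norm_mult3] mult_mono) auto
        qed
        also have "\<dots> = K * K * 1 * \<theta> * exp (- k * real (n - i))"
          by (simp add: k_def algebra_simps flip: exp_add)
        also have "\<dots> \<le> K * K * exp r * \<theta> * exp (- k * real (n - i))"
          using K \<theta> r by (intro mult_right_mono mult_left_mono) auto
        finally show ?thesis unfolding * .
      qed
      then have "op_norm ((?Y - cocycle f A n x) ** matrix_inv ?Y) \<le> (\<Sum>i<n. K * K * exp r * \<theta> * exp (- k * real (n - i)))"
        unfolding cocycle_diff matrix_mult_sum_left
        by (auto intro!: order_trans[OF op_norm_sum] sum_mono simp del: funpow.simps)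
      also have "\<dots> = K * K * exp r * \<theta> * (\<Sum>i<n. exp (- k * real (n - i)))"
        by (simp only: sum_distrib_left)
      also have "\<dots> \<le> K * K * exp r * \<theta> * (1 / (1 - exp (- k)))"
        using K \<theta> k by (intro mult_left_mono sum_exp_rev_le) auto
      finally show ?thesis by (simp add: S_def)
    qed
    have "?Y - cocycle f A n x = (?Y - cocycle f A n x) ** matrix_inv ?Y ** ?Y"
      using y by (simp add: matrix_inv_left inv flip: matrix_mul_assoc)
    then have "op_norm (?Y - cocycle f A n x) \<le> op_norm ((?Y - cocycle f A n x) ** matrix_inv ?Y) * op_norm ?Y"
      by (metis op_norm_mult)
    also have "\<dots> \<le> S * \<theta> * (1 + S * \<theta>)"
      using XY Y op_norm_triangle_le_add_diff[of ?Y "mat 1"] S \<theta> by (intro mult_mono) auto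
    finally have "op_norm (cocycle f A n x - mat 1) \<le> S * \<theta> * (1 + S * \<theta>) + S * \<theta>"
      using Y op_norm_minus_commute[of "cocycle f A n x" ?Y]
        op_norm_triangle[of "cocycle f A n x - ?Y" "?Y - mat 1"] by simp
    also have "\<dots> = S * \<theta> * (2 + S * \<theta>)"
      by (simp add: algebra_simps)
    also have "\<dots> \<le> S * \<theta> * (2 + S * (h * c powr \<alpha> * \<delta>\<^sub>0 powr \<alpha>))"
    proof -
      have "d \<le> c * \<delta>\<^sub>0" using ret c_pos by (simp add: d_def)
      then have "d powr \<alpha> \<le> (c * \<delta>\<^sub>0) powr \<alpha>"
        using d assms(1) by (intro powr_mono2) auto
      then have "\<theta> \<le> h * c powr \<alpha> * \<delta>\<^sub>0 powr \<alpha>"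
        using h(1) c_pos \<delta>\<^sub>0_pos by (simp add: \<theta>_def powr_mult)
      then show ?thesis using S \<theta> by (intro mult_left_mono add_left_mono) auto
    qed
    also have "\<dots> = Q * dist x ((f ^^ n) x) powr \<alpha>"
      using c_pos by (simp add: Q_def \<theta>_def d_def powr_mult)
    finally show ?thesis .
  qed
  moreover have "0 \<le> Q" using S h(1) by (simp add: Q_def)
  ultimately show ?thesis using that by blast
qed

end

section \<open>Transfer functions on a dense orbit\<close>

text \<open>
  The hypothesis compares \<open>C\<close> multiplicatively at nearby points. Covering \<open>S\<close> by finitely many balls
  centred in \<open>S\<close> bounds \<open>C\<close> and its inverse by their values at the centres, and then the multiplicative
  estimate becomes an additive one.
\<close>

lemma holder_GL_if_locally_near:
  fixes S :: "'a::metric_space set" and C :: "'a \<Rightarrow> real^'m^'m"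
  assumes "compact (closure S)" "C \<in> S \<rightarrow> GL" "0 < \<alpha>" "0 < \<rho>" "0 \<le> Q" "Q * \<rho> powr \<alpha> \<le> 1"
    and near: "\<And>x y. x \<in> S \<Longrightarrow> y \<in> S \<Longrightarrow> dist x y < \<rho> \<Longrightarrow>
      op_norm (C x ** matrix_inv (C y) - mat 1) \<le> Q * dist x y powr \<alpha>"
  shows "holder_GL \<alpha> S C"
proof -
  have inv: "invertible (C x)" if "x \<in> S" for x
    using assms(2) that by (auto simp: GL_def)
  have near2: "op_norm (C x ** matrix_inv (C y)) \<le> 2" if "x \<in> S" "y \<in> S" "dist x y < \<rho>" for x y
  proof -
    have "Q * dist x y powr \<alpha> \<le> Q * \<rho> powr \<alpha>"
      using assms(3-5) that by (intro mult_left_mono powr_mono2) auto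
    then show ?thesis
      using near[OF that] assms(6) op_norm_triangle_le_add_diff[of "C x ** matrix_inv (C y)" "mat 1"] by simp
  qed
  have cover: "closure S \<subseteq> (\<Union>a\<in>S. ball a \<rho>)"
    using assms(4) by (auto simp: closure_approachable)
  have "open (ball a \<rho>)" for a :: 'a by simp
  from compactE_image[where f = "\<lambda>a. ball a \<rho>", OF assms(1) this cover]
  obtain F where F: "F \<subseteq> S" "finite F" "closure S \<subseteq> (\<Union>a\<in>F. ball a \<rho>)" .
  define b where "b = 2 * (\<Sum>a\<in>F. op_norm (C a) + op_norm (matrix_inv (C a)))"
  have bound: "op_norm (C x) \<le> b" "op_norm (matrix_inv (C x)) \<le> b" if xS: "x \<in> S" for x
  proof -
    obtain a where a: "a \<in> F" "dist a x < \<rho>" "a \<in> S"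
    proof -
      have "x \<in> (\<Union>a\<in>F. ball a \<rho>)"
        using F(3) xS closure_subset[of S] by blast
      then obtain a where "a \<in> F" "x \<in> ball a \<rho>" by (rule UN_E)
      then show ?thesis using F(1) by (intro that[of a]) auto
    qed
    have le: "op_norm (C a) + op_norm (matrix_inv (C a)) \<le> (\<Sum>a\<in>F. op_norm (C a) + op_norm (matrix_inv (C a)))"
      using F a by (intro member_le_sum) auto
    have "C x = C x ** matrix_inv (C a) ** C a"
      using a by (simp add: matrix_inv_left inv flip: matrix_mul_assoc)
    then have "op_norm (C x) \<le> op_norm (C x ** matrix_inv (C a)) * op_norm (C a)"
      by (metis op_norm_mult)
    also have "\<dots> \<le> 2 * op_norm (C a)"
      using a xS by (intro mult_right_mono near2) (auto simp: dist_commute)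
    finally show "op_norm (C x) \<le> b"
      using le op_norm_nonneg[of "matrix_inv (C a)"] unfolding b_def by linarith
    have "matrix_inv (C x) = matrix_inv (C a) ** (C a ** matrix_inv (C x))"
      using a by (simp add: matrix_inv_left inv matrix_mul_assoc)
    then have "op_norm (matrix_inv (C x)) \<le> op_norm (matrix_inv (C a)) * op_norm (C a ** matrix_inv (C x))"
      by (metis op_norm_mult)
    also have "\<dots> \<le> op_norm (matrix_inv (C a)) * 2"
      using a xS by (intro mult_left_mono near2) auto
    finally show "op_norm (matrix_inv (C x)) \<le> b"
      using le op_norm_nonneg[of "C a"] unfolding b_def by linarith
  qed
  have b: "0 \<le> b" unfolding b_def by (intro mult_nonneg_nonneg sum_nonneg add_nonneg_nonneg) auto
  define h where "h = Q * b + 2 * b / \<rho> powr \<alpha>"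
  have h_ge: "Q * b \<le> h" "2 * b / \<rho> powr \<alpha> \<le> h"
    using b assms(5) by (simp_all add: h_def)
  have h_nonneg: "0 \<le> h"
    using b assms(5) by (intro order_trans[OF mult_nonneg_nonneg h_ge(1)])
  have h: "op_norm (C x - C y) \<le> h * dist x y powr \<alpha>" if "x \<in> S" "y \<in> S" for x y
  proof (cases "dist x y < \<rho>")
    case True
    have "C x - C y = (C x ** matrix_inv (C y) - mat 1) ** C y"
      using that by (simp add: matrix_mult_diff_distrib_right matrix_inv_left inv flip: matrix_mul_assoc)
    then have "op_norm (C x - C y) \<le> op_norm (C x ** matrix_inv (C y) - mat 1) * op_norm (C y)"
      by (metis op_norm_mult)
    also have "\<dots> \<le> (Q * dist x y powr \<alpha>) * b"
      using that True near bound assms(5) by (intro mult_mono) auto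
    also have "\<dots> = Q * b * dist x y powr \<alpha>" by simp
    also have "\<dots> \<le> h * dist x y powr \<alpha>"
      by (intro mult_right_mono h_ge) simp
    finally show ?thesis .
  next
    case False
    have "op_norm (C x - C y) \<le> op_norm (C x) + op_norm (C y)"
      using op_norm_triangle[of "C x" "- C y"] by (simp add: op_norm_minus)
    also have "\<dots> \<le> 2 * b / \<rho> powr \<alpha> * \<rho> powr \<alpha>"
      using bound(1)[OF that(1)] bound(1)[OF that(2)] assms(4) by simp
    also have "\<dots> \<le> 2 * b / \<rho> powr \<alpha> * dist x y powr \<alpha>"
      using False b assms(3,4) by (intro mult_left_mono powr_mono2) auto
    also have "\<dots> \<le> h * dist x y powr \<alpha>"
      by (intro mult_right_mono h_ge) simp
    finally show ?thesis .
  qed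
  have "op_norm (matrix_inv (C x) - matrix_inv (C y)) \<le> b * (h * dist x y powr \<alpha>) * b" if "x \<in> S" "y \<in> S" for x y
  proof -
    have "matrix_inv (C x) - matrix_inv (C y) = matrix_inv (C x) ** (C y - C x) ** matrix_inv (C y)"
      using that by (simp add: matrix_mult_diff_distrib_right matrix_mult_diff_distrib_left
          matrix_inv_left matrix_inv_right inv flip: matrix_mul_assoc)
    then have "op_norm (matrix_inv (C x) - matrix_inv (C y))
        \<le> op_norm (matrix_inv (C x)) * op_norm (C y - C x) * op_norm (matrix_inv (C y))"
      by (simp only: op_norm_mult3)
    also have "\<dots> \<le> b * (h * dist x y powr \<alpha>) * b"
      using that bound b h[OF that] op_norm_minus_commute[of "C x" "C y"]
      by (intro mult_mono) (auto intro!: mult_nonneg_nonneg h_nonneg)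
    finally show ?thesis .
  qed
  note inverse_le = this
  have "dist_GL (C x) (C y) \<le> (h + b * h * b) * dist x y powr \<alpha>" if "x \<in> S" "y \<in> S" for x y
    using h[OF that] inverse_le[OF that] by (simp add: dist_GL_def algebra_simps)
  then show ?thesis unfolding holder_GL_def using assms(2) by blast
qed

lemma uniformly_continuous_on_if_holder:
  fixes S :: "'a::metric_space set" and C :: "'a \<Rightarrow> real^'m^'m"
  assumes "0 < \<alpha>" "0 < h" "\<And>x y. x \<in> S \<Longrightarrow> y \<in> S \<Longrightarrow> op_norm (C x - C y) \<le> h * dist x y powr \<alpha>"
  shows "uniformly_continuous_on S C"
  unfolding uniformly_continuous_on_def
proof (intro allI impI)
  fix e :: real assume e: "0 < e"
  define H where "H = (real CARD('m))\<^sup>2 * h"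
  have H: "0 < H" using assms(2) by (simp add: H_def)
  have "dist (C x') (C x) < e" if "x \<in> S" "x' \<in> S" "dist x' x < (e / H) powr (1 / \<alpha>)" for x x'
  proof -
    have "dist (C x') (C x) \<le> (real CARD('m))\<^sup>2 * op_norm (C x' - C x)"
      unfolding dist_norm by (rule norm_le_op_norm)
    also have "\<dots> \<le> (real CARD('m))\<^sup>2 * (h * dist x' x powr \<alpha>)"
      using assms(3)[OF that(2,1)] by (intro mult_left_mono) auto
    also have "\<dots> < H * ((e / H) powr (1 / \<alpha>)) powr \<alpha>"
      unfolding H_def[symmetric] mult.assoc[symmetric]
      using H that(3) assms(1) by (intro mult_strict_left_mono powr_less_mono2) auto
    also have "\<dots> = e" using e H assms(1) by (simp add: powr_powr)
    finally show ?thesis .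
  qed
  then show "\<exists>d>0. \<forall>x\<in>S. \<forall>x'\<in>S. dist x' x < d \<longrightarrow> dist (C x') (C x) < e"
    using e H by (intro exI[of _ "(e / H) powr (1 / \<alpha>)"]) auto
qed

text \<open>
  The functions \<open>C\<close> and \<open>x \<mapsto> C(x)\<inverse>\<close> are extended separately; the product of the extensions is the identity by
  continuity, so that the extension of \<open>C\<close> stays invertible.
\<close>

lemma holder_GL_extends_to_closure:
  fixes S :: "'a::metric_space set" and C :: "'a \<Rightarrow> real^'m^'m"
  assumes "0 < \<alpha>" "holder_GL \<alpha> S C"
  obtains C' where "holder_GL \<alpha> (closure S) C'" "\<And>x. x \<in> S \<Longrightarrow> C' x = C x"
proof -
  obtain h where h: "0 < h"
    "\<And>x y. x \<in> S \<Longrightarrow> y \<in> S \<Longrightarrow> op_norm (C x - C y) \<le> h * dist x y powr \<alpha>"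
    "\<And>x y. x \<in> S \<Longrightarrow> y \<in> S \<Longrightarrow> op_norm (matrix_inv (C x) - matrix_inv (C y)) \<le> h * dist x y powr \<alpha>"
    using holder_GL_op_norm[OF assms(2)] by metis
  obtain C' where C': "uniformly_continuous_on (closure S) C'" "\<And>x. x \<in> S \<Longrightarrow> C x = C' x"
    using uniformly_continuous_on_extension_on_closure[OF uniformly_continuous_on_if_holder[OF assms(1) h(1,2)]] by metis
  obtain D' where D': "uniformly_continuous_on (closure S) D'" "\<And>x. x \<in> S \<Longrightarrow> matrix_inv (C x) = D' x"
    using uniformly_continuous_on_extension_on_closure[OF uniformly_continuous_on_if_holder[OF assms(1) h(1,3)]] by metis
  have lim: "(\<lambda>n. g (u n)) \<longlonglongrightarrow> g x"
    if "uniformly_continuous_on (closure S) g" "u \<longlonglongrightarrow> x" "\<And>n. u n \<in> S" "x \<in> closure S"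
    for g :: "'a \<Rightarrow> real^'m^'m" and u x
    using continuous_on_tendsto_compose[OF uniformly_continuous_imp_continuous[OF that(1)] that(2,4)]
      that(3) closure_subset[of S] by (simp add: subset_eq)
  have holder: "op_norm (g x - g y) \<le> h * dist x y powr \<alpha>"
    if g: "uniformly_continuous_on (closure S) g"
      and gS: "\<And>x y. x \<in> S \<Longrightarrow> y \<in> S \<Longrightarrow> op_norm (g x - g y) \<le> h * dist x y powr \<alpha>"
      and xy: "x \<in> closure S" "y \<in> closure S" for g :: "'a \<Rightarrow> real^'m^'m" and x y
  proof -
    obtain u v where u: "\<And>n. u n \<in> S" "u \<longlonglongrightarrow> x" and v: "\<And>n. v n \<in> S" "v \<longlonglongrightarrow> y"
      using xy unfolding closure_sequential by metis
    have "(\<lambda>n. op_norm (g (u n) - g (v n))) \<longlonglongrightarrow> op_norm (g x - g y)"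
      by (intro tendsto_op_norm tendsto_diff lim g u v xy)
    moreover have "(\<lambda>n. h * dist (u n) (v n) powr \<alpha>) \<longlonglongrightarrow> h * dist x y powr \<alpha>"
      using assms(1) by (intro tendsto_intros tendsto_powr' u v) auto
    ultimately show ?thesis
      by (rule LIMSEQ_le) (use gS u v in auto)
  qed
  have inv: "C' x ** D' x = mat 1" if x: "x \<in> closure S" for x
  proof -
    obtain u where u: "\<And>n. u n \<in> S" "u \<longlonglongrightarrow> x"
      using x unfolding closure_sequential by metis
    have "(\<lambda>n. C' (u n) ** D' (u n)) \<longlonglongrightarrow> C' x ** D' x"
      by (intro tendsto_matrix_mult lim C' D' u x)
    moreover have "C' (u n) ** D' (u n) = mat 1" for n
      using u C'(2) D'(2) matrix_inv_right[OF holder_GL_invertible[OF assms(2)]] by metis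
    ultimately show ?thesis by (simp add: LIMSEQ_const_iff)
  qed
  have "dist_GL (C' x) (C' y) \<le> 2 * h * dist x y powr \<alpha>" if "x \<in> closure S" "y \<in> closure S" for x y
  proof -
    have "op_norm (C' x - C' y) \<le> h * dist x y powr \<alpha>"
      by (rule holder[OF C'(1) _ that]) (simp add: h(2) flip: C'(2))
    moreover have "op_norm (D' x - D' y) \<le> h * dist x y powr \<alpha>"
      by (rule holder[OF D'(1) _ that]) (simp add: h(3) flip: D'(2))
    ultimately show ?thesis
      unfolding dist_GL_def using matrix_inv_eqI(2)[OF inv] that by simp
  qed
  moreover have "C' \<in> closure S \<rightarrow> GL"
    using matrix_inv_eqI(1)[OF inv] by (auto simp: GL_def)
  ultimately have "holder_GL \<alpha> (closure S) C'"
    unfolding holder_GL_def by blast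
  then show ?thesis by (rule that) (simp add: C'(2))
qed

section \<open>The cohomological equation\<close>

lemma int_iterate_orbit:
  assumes "homeomorphism X X f g" "z \<in> X"
  shows "int_iterate X f k z \<in> X" and "int_iterate X f (k + 1) z = f (int_iterate X f k z)"
proof -
  have im: "f ` X = X" using assms(1) by (simp add: homeomorphism_def)
  have backward: "(inv_into X f ^^ n) z \<in> X" for n
    using assms(2) im by (induction n) (auto intro: inv_into_into)
  show "int_iterate X f k z \<in> X"
    using backward funpow_in[of f X z] assms(2) im by (simp add: int_iterate_def)
  show "int_iterate X f (k + 1) z = f (int_iterate X f k z)"
  proof (cases "k \<ge> 0")
    case True
    then show ?thesis by (simp add: int_iterate_def nat_add_distrib)
  next
    case False
    define n where "n = nat (- k - 1)"
    have n: "nat (- k) = Suc n" "k + 1 = - int n"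
      using False by (auto simp: n_def)
    have "int_iterate X f (k + 1) z = (inv_into X f ^^ n) z"
      unfolding int_iterate_def n(2) by (cases n) (simp_all add: nat_add_distrib)
    moreover have "int_iterate X f k z = inv_into X f ((inv_into X f ^^ n) z)"
      using n(1) False by (simp add: int_iterate_def)
    moreover have "f (inv_into X f ((inv_into X f ^^ n) z)) = (inv_into X f ^^ n) z"
      using backward[of n] im by (intro f_inv_into_f) simp
    ultimately show ?thesis by simp
  qed
qed

text \<open>
  \<open>E k\<close> is taken to be the product along the orbit from time \<open>0\<close> to time \<open>k\<close>; for negative \<open>k\<close> this is the
  inverse of the product from \<open>k\<close> to \<open>0\<close>.
\<close>

lemma cocycle_along_integer_orbit:
  fixes A :: "'a \<Rightarrow> real^'m^'m" and u :: "int \<Rightarrow> 'a"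
  assumes "f ` X \<subseteq> X" "A \<in> X \<rightarrow> GL" "\<And>k. u k \<in> X" "\<And>k. u (k + 1) = f (u k)"
  obtains E :: "int \<Rightarrow> real^'m^'m" where "\<And>k. invertible (E k)" "\<And>k n. E (k + int n) = cocycle f A n (u k) ** E k"
proof -
  have inv: "invertible (cocycle f A n (u k))" for n k
    by (rule invertible_cocycle[OF assms(1-3)])
  have iter: "(f ^^ n) (u k) = u (k + int n)" for n k
    by (induction n) (simp_all add: assms(4)[symmetric] add_ac)
  define E where "E k = (if k \<ge> 0 then cocycle f A (nat k) (u 0)
    else matrix_inv (cocycle f A (nat (- k)) (u k)))" for k
  have E_inv: "invertible (E k)" for k
    by (simp add: E_def inv invertible_matrix_inv)
  have step: "E (k + 1) = A (u k) ** E k" for k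
  proof (cases "k \<ge> 0")
    case True
    then show ?thesis
      using iter[of "nat k" 0] by (simp add: E_def nat_add_distrib)
  next
    case False
    define n where "n = nat (- k - 1)"
    have n: "nat (- k) = Suc n" "k + 1 = - int n" using False by (auto simp: n_def)
    have split: "cocycle f A (Suc n) (u k) = cocycle f A n (u (k + 1)) ** A (u k)"
      using cocycle_add[of f A n 1 "u k"] by (simp add: assms(4))
    have "invertible (A (u k))" using assms(2,3) by (auto simp: GL_def)
    then have "A (u k) ** matrix_inv (cocycle f A (Suc n) (u k)) = matrix_inv (cocycle f A n (u (k + 1)))"
      unfolding split by (simp add: matrix_inv_mult inv matrix_mul_assoc matrix_inv_right)
    moreover have "E k = matrix_inv (cocycle f A (Suc n) (u k))"
      using False n(1) by (simp add: E_def)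
    moreover have "E (k + 1) = matrix_inv (cocycle f A n (u (k + 1)))"
      unfolding E_def n(2) by (cases n) (simp_all add: nat_add_distrib)
    ultimately show ?thesis by simp
  qed
  have "E (k + int n) = cocycle f A n (u k) ** E k" for k n
  proof (induction n)
    case (Suc n)
    have "E (k + int (Suc n)) = A (u (k + int n)) ** E (k + int n)"
      using step[of "k + int n"] by (simp add: add_ac)
    then show ?case by (simp add: Suc iter matrix_mul_assoc)
  qed simp
  with E_inv show ?thesis by (rule that)
qed

context closing_system
begin

text \<open>
  The transfer function is the product along the orbit from \<open>u 0\<close> to \<open>u k\<close>. It depends only on the point
  \<open>u k\<close> because the periodic products are trivial, and its values at two nearby points of the orbit differ by
  the product over a returning segment or its inverse.
\<close>

lemma transfer_function_on_orbit:
  fixes A :: "'a \<Rightarrow> real^'m^'m" and u :: "int \<Rightarrow> 'a"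
  assumes "0 < \<alpha>" "holder_GL \<alpha> X A"
    and periodic: "\<And>p n. p \<in> X \<Longrightarrow> 0 < n \<Longrightarrow> (f ^^ n) p = p \<Longrightarrow> cocycle f A n p = mat 1"
    and u: "\<And>k. u k \<in> X" "\<And>k. u (k + 1) = f (u k)"
  obtains C :: "'a \<Rightarrow> real^'m^'m" where "holder_GL \<alpha> (range u) C" "\<And>x. x \<in> range u \<Longrightarrow> C (f x) = A x ** C x"
proof -
  have GL: "A \<in> X \<rightarrow> GL" using assms(2) by (simp add: holder_GL_def)
  obtain E :: "int \<Rightarrow> real^'m^'m" where E: "\<And>k. invertible (E k)" "\<And>k n. E (k + int n) = cocycle f A n (u k) ** E k"
    using cocycle_along_integer_orbit[where f = f and A = A and u = u and X = X, OF maps GL u] by blast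
  have iter: "(f ^^ n) (u k) = u (k + int n)" for n k
    by (induction n) (simp_all add: u(2)[symmetric] add_ac)
  have later: "\<exists>n>0. j = i + int n" if "i < j" for i j :: int
    using zero_less_imp_eq_int[of "j - i"] that by (auto simp: algebra_simps)
  have "E i = E j" if less: "i < j" and eq: "u i = u j" for i j
  proof -
    obtain n where "0 < n" "j = i + int n" using later[OF less] by blast
    then show ?thesis
      using periodic[OF u(1), of n i] iter[of n i] eq E(2)[of i n] by simp
  qed
  then have well_defined: "E i = E j" if "u i = u j" for i j
    using that by (metis linorder_neqE_linordered_idom)
  define C where "C x = E (SOME k. u k = x)" for x
  have C: "C (u k) = E k" for k
    unfolding C_def by (rule well_defined) (rule someI[of "\<lambda>j. u j = u k" k], simp)
  obtain Q where Q: "0 \<le> Q" and near: "\<And>x n. x \<in> X \<Longrightarrow> 0 < n \<Longrightarrow> dist x ((f ^^ n) x) < \<delta>\<^sub>0 \<Longrightarrow>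
      op_norm (cocycle f A n x - mat 1) \<le> Q * dist x ((f ^^ n) x) powr \<alpha>"
    using cocycle_near_one_on_return[OF assms(1-3)] by metis
  \<comment> \<open>makes the deviation \<open>Q \<rho>\<^sup>\<alpha>\<close> at most one half, so that passing to inverses only doubles it\<close>
  define \<rho> where "\<rho> = min \<delta>\<^sub>0 ((1 / (2 * (Q + 1))) powr (1 / \<alpha>))"
  have \<rho>: "0 < \<rho>" "\<rho> \<le> \<delta>\<^sub>0"
    using Q \<delta>\<^sub>0_pos by (auto simp: \<rho>_def)
  have small: "Q * t powr \<alpha> \<le> 1 / 2" if "0 \<le> t" "t \<le> \<rho>" for t
  proof -
    have "t powr \<alpha> \<le> ((1 / (2 * (Q + 1))) powr (1 / \<alpha>)) powr \<alpha>"
      using that assms(1) by (intro powr_mono2) (auto simp: \<rho>_def)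
    also have "\<dots> = 1 / (2 * (Q + 1))"
      using assms(1) Q by (simp add: powr_powr)
    finally have "Q * t powr \<alpha> \<le> Q * (1 / (2 * (Q + 1)))"
      using Q by (rule mult_left_mono)
    also have "\<dots> \<le> 1 / 2" using Q by (simp add: field_simps)
    finally show ?thesis .
  qed
  have "holder_GL \<alpha> (range u) C"
  proof (rule holder_GL_if_locally_near)
    have "closure (range u) \<subseteq> X"
      using u(1) compact_X by (intro closure_minimal) (auto simp: compact_imp_closed)
    then show "compact (closure (range u))"
      using compact_X by (metis closed_closure compact_Int_closed inf.absorb_iff2)
    show "C \<in> range u \<rightarrow> GL" using E(1) C by (auto simp: GL_def)
    show "0 < \<alpha>" "0 < \<rho>" "0 \<le> 2 * Q" using assms(1) \<rho> Q by auto
    show "2 * Q * \<rho> powr \<alpha> \<le> 1" using small[of \<rho>] \<rho> by simp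
    have forward: "op_norm (cocycle f A n (u i) - mat 1) \<le> Q * dist (u i) (u j) powr \<alpha>"
        "op_norm (cocycle f A n (u i) - mat 1) \<le> 1 / 2"
        if "0 < n" "j = i + int n" "dist (u i) (u j) < \<rho>" for i j n
      using near[OF u(1) that(1), of i] iter[of n i] that \<rho> small[of "dist (u i) (u j)"] by auto
    show "op_norm (C x ** matrix_inv (C y) - mat 1) \<le> 2 * Q * dist x y powr \<alpha>"
      if xy: "x \<in> range u" "y \<in> range u" and d: "dist x y < \<rho>" for x y
    proof -
      obtain i j where ij: "x = u i" "y = u j" using xy by auto
      have nonneg: "0 \<le> Q * dist x y powr \<alpha>" using Q by simp
      consider "i = j" | "i < j" | "j < i" by linarith
      then show ?thesis
      proof cases
        case 1
        then show ?thesis using E(1) nonneg by (simp add: ij C matrix_inv_right)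
      next
        case 2
        then obtain n where n: "0 < n" "j = i + int n" using later by blast
        let ?M = "cocycle f A n (u i)"
        have M: "invertible ?M" by (rule invertible_cocycle[OF maps GL u(1)])
        have "C x ** matrix_inv (C y) = E i ** (matrix_inv (E i) ** matrix_inv ?M)"
          by (simp add: ij C n(2) E matrix_inv_mult M)
        also have "\<dots> = matrix_inv ?M"
          by (simp add: matrix_mul_assoc matrix_inv_right E(1))
        finally show ?thesis
          using op_norm_inverse_near_one(2)[OF M forward(2)[OF n]] forward(1)[OF n] d by (simp add: ij)
      next
        case 3
        then obtain n where n: "0 < n" "i = j + int n" using later by blast
        have "C x ** matrix_inv (C y) = cocycle f A n (u j)"
          by (simp add: ij C n(2) E matrix_inv_right flip: matrix_mul_assoc)
        then show ?thesis
          using forward(1)[OF n] d nonneg by (simp add: ij dist_commute)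
      qed
    qed
  qed
  moreover have "C (f x) = A x ** C x" if x: "x \<in> range u" for x
  proof -
    obtain k where k: "x = u k" using x by auto
    show ?thesis using E(2)[of k 1] C[of "k + 1"] by (simp add: k C u(2))
  qed
  ultimately show ?thesis by (rule that)
qed

end

lemma continuous_on_if_holder_GL:
  fixes A :: "'a::metric_space \<Rightarrow> real^'m^'m"
  assumes "0 < \<alpha>" "holder_GL \<alpha> X A"
  shows "continuous_on X A"
proof -
  obtain h where h: "0 < h" "\<And>x y. x \<in> X \<Longrightarrow> y \<in> X \<Longrightarrow> op_norm (A x - A y) \<le> h * dist x y powr \<alpha>"
    using holder_GL_op_norm[OF assms(2)] by metis
  show ?thesis
    using uniformly_continuous_on_if_holder[OF assms(1) h] by (rule uniformly_continuous_imp_continuous)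
qed

theorem theorem1p1:
  fixes X :: "('a::metric_space) set"
    and f :: "'a \<Rightarrow> 'a"
    and A :: "'a \<Rightarrow> real^'m^'m"
    and \<alpha> :: real
  assumes "compact X"
    and "\<exists>g. homeomorphism X X f g"
    and "topologically_transitive X f"
    and "closing_property X f"
    and "\<alpha> > 0"
    and "holder_GL \<alpha> X A"
    and "\<And>p n. p \<in> X \<Longrightarrow> n > 0 \<Longrightarrow> (f ^^ n) p = p \<Longrightarrow> cocycle f A n p = mat 1"
  shows "\<exists>C :: 'a \<Rightarrow> real^'m^'m. holder_GL \<alpha> X C \<and>
           (\<forall>x\<in>X. A x = C (f x) ** matrix_inv (C x))"
proof -
  obtain g where g: "homeomorphism X X f g" using assms(2) by blast
  then have im: "f ` X = X" and cont_f: "continuous_on X f"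
    by (auto simp: homeomorphism_def)
  obtain z where z: "z \<in> X" "X \<subseteq> closure (range (\<lambda>k. int_iterate X f k z))"
    using assms(3) unfolding topologically_transitive_def by blast
  define u where "u = (\<lambda>k. int_iterate X f k z)"
  have u: "u k \<in> X" "u (k + 1) = f (u k)" for k
    unfolding u_def by (rule int_iterate_orbit[OF g z(1)])+
  have dense: "closure (range u) = X"
    using u(1) assms(1) z(2) by (intro antisym closure_minimal) (auto simp: compact_imp_closed u_def)
  obtain c l \<delta>\<^sub>0 where "closing_system X f c l \<delta>\<^sub>0"
    using closing_system_exists[OF assms(1) _ assms(4)] im by blast
  then interpret closing_system X f c l \<delta>\<^sub>0 .
  obtain C\<^sub>0 where C\<^sub>0: "holder_GL \<alpha> (range u) C\<^sub>0" "\<And>x. x \<in> range u \<Longrightarrow> C\<^sub>0 (f x) = A x ** C\<^sub>0 x"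
    using transfer_function_on_orbit[where u = u, OF assms(5-7) u] by blast
  obtain C where C: "holder_GL \<alpha> (closure (range u)) C" "\<And>x. x \<in> range u \<Longrightarrow> C x = C\<^sub>0 x"
    using holder_GL_extends_to_closure[OF assms(5) C\<^sub>0(1)] by blast
  have holder: "holder_GL \<alpha> X C" using C(1) unfolding dense .
  have cont: "continuous_on X C" "continuous_on X A"
    using continuous_on_if_holder_GL assms(5,6) holder by blast+
  have "C (f x) = A x ** C x" if x: "x \<in> X" for x
  proof -
    obtain v where v: "\<And>n. v n \<in> range u" "v \<longlonglongrightarrow> x"
      using x unfolding dense[symmetric] closure_sequential by metis
    have vX: "v n \<in> X" for n using v(1)[of n] u(1) by auto
    have lim: "(\<lambda>n. h (v n)) \<longlonglongrightarrow> h x" if "continuous_on X h" for h :: "'a \<Rightarrow> real^'m^'m"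
      using continuous_on_tendsto_compose[OF that v(2) x] vX by simp
    have "continuous_on X (\<lambda>x. C (f x))"
      using continuous_on_compose2[OF cont(1) cont_f] im by simp
    then have "(\<lambda>n. C (f (v n))) \<longlonglongrightarrow> C (f x)"
      by (rule lim)
    moreover have "C (f (v n)) = A (v n) ** C (v n)" for n
    proof -
      obtain k where k: "v n = u k" using v(1)[of n] by auto
      then have "f (v n) \<in> range u" using u(2)[of k] by (metis rangeI)
      then show ?thesis using C(2) C\<^sub>0(2) v(1) by simp
    qed
    ultimately have "(\<lambda>n. A (v n) ** C (v n)) \<longlonglongrightarrow> C (f x)" by simp
    moreover have "(\<lambda>n. A (v n) ** C (v n)) \<longlonglongrightarrow> A x ** C x"
      by (intro tendsto_matrix_mult lim cont)
    ultimately show ?thesis by (rule LIMSEQ_unique)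
  qed
  then have "A x = C (f x) ** matrix_inv (C x)" if "x \<in> X" for x
    using that by (simp add: matrix_inv_right holder_GL_invertible[OF holder] flip: matrix_mul_assoc)
  with holder show ?thesis by blast
qed

end
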